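(* Let $q=p^r$ be a prime power ($p$ prime), let $M$ be chosen uniformly at random from $\mathrm{SL}(n,\mathbb{F}_q)$, and let $1\le k\le n$. For any elements $a_i\in\mathbb{F}_q$ indexed by the integers $1\le i\le k$ with $p\nmid i$, $$\left|\mathbb{P}_{M\in\mathrm{SL}(n,\mathbb{F}_q)}\big(\forall\,1\le i\le k\text{ with }p\nmid i:\ \mathrm{Tr}(M^i)=a_i\big)-\frac{1}{q^{k-\lfloor k/p\rfloor}}\right|\le\frac{(q-1)(k+1)\,q^{\lfloor k/p\rfloor}}{q^n}.$$
   Context: $\mathrm{SL}(n,\mathbb{F}_q)$ is the group of $n\times n$ matrices over $\mathbb{F}_q$ of determinant $1$, with uniform probability measure. *)

theory Defs
  imports "Jordan_Normal_Form.Determinant" "HOL-Computational_Algebra.Primes"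
begin

definition mat_trace :: "'a::semiring_0 mat \<Rightarrow> 'a" where
  "mat_trace A = (\<Sum>i<dim_row A. A $$ (i, i))"

definition SL_mat :: "nat \<Rightarrow> 'a::comm_ring_1 mat set" where
  "SL_mat n = {M \<in> carrier_mat n n. det M = 1}"

end

(* Count pairs (M, v) of a matrix and a vector according to the dimension d of the cyclic subspace
   spanned by v, M v, M^2 v, ...  Completing v, ..., M^(d-1) v to a basis conjugates M into a block
   upper triangular matrix with a d x d companion block and an arbitrary (n-d) x (n-d) block D, so
     q^n #{M. chi_M in Phi} = sum_d |GL_n| / |GL_(n-d)| * sum_D #{g monic of degree d. g * chi_D in Phi}.
   For Phi the polynomials with constant term (-1)^n and prescribed k leading coefficients below the
   top one, the inner count is exactly q^(d-k-1) if d > k and D is invertible, and at most 1 if d <= k;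
   hence such a prefix has probability q^(-k) up to (q-1)(k+1)/q^n in SL_n.  By Newton's identities
   the prescribed traces are compatible with exactly q^(k div p) prefixes, the coefficients with index
   divisible by p being free. *)
theory Submission
  imports Defs "Jordan_Normal_Form.Char_Poly"
begin

text \<open>In general the characteristic polynomial is not equidistributed on the special linear
  group, and counting conjugacy classes would not give a uniform error. The auxiliary vector cures
  this: for each fixed \<open>D\<close> it releases a factor \<open>g\<close> that runs freely over
  the monic polynomials of degree d, so the condition on the product can be counted for one
  \<open>D\<close> at a time. No completion to a basis is ever chosen. All of them are counted:
  their number depends only on n and d, so double counting triples (M, v, P) costs a constant
  factor. A singular \<open>D\<close> contributes nothing, because the prescribed constant term is
  nonzero. The sum over the remaining \<open>D\<close>, divided by |GL_(n-d)|, is therefore a mean.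
  The k + 1 dimensions d = 0, ..., k, where this mean is only known to lie between 0 and 1, produce
  the factor k + 1. The factor q - 1 is |GL_n| / |SL_n|; it also cancels the denominator of the
  geometric sum over d > k.\<close>

section \<open>Newton's identities\<close>

lemma mat_trace_add:
  assumes "A \<in> carrier_mat n n" "B \<in> carrier_mat n n"
  shows "mat_trace (A + B) = mat_trace A + mat_trace B"
  using assms by (auto simp: mat_trace_def sum.distrib)

lemma mat_trace_smult:
  assumes "A \<in> carrier_mat n n"
  shows "mat_trace (c \<cdot>\<^sub>m A) = c * mat_trace A"
  using assms by (auto simp: mat_trace_def sum_distrib_left)

lemma mat_trace_one: "mat_trace (1\<^sub>m n) = of_nat n"
  by (simp add: mat_trace_def)

lemma mat_trace_zero: "mat_trace (0\<^sub>m n n) = 0"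
  by (simp add: mat_trace_def)

lemma char_poly_matrix_mat_delete:
  assumes "M \<in> carrier_mat n n" "i < n"
  shows "mat_delete (char_poly_matrix M) i i = char_poly_matrix (mat_delete M i i)"
  using assms by (intro eq_matI) (auto simp: char_poly_matrix_def mat_delete_def)

text \<open>Take traces of the coefficients of (t - M) adj (t - M) = chi(t), using that the trace of
  the adjugate is chi'. Nothing is divided by an integer, so the identity holds in every
  characteristic.\<close>

lemma newton_char_poly:
  fixes M :: "'a::idom mat"
  assumes M: "M \<in> carrier_mat n n" and "i \<le> n"
  shows "of_nat (n - i) * coeff (char_poly M) (n - i)
    = (\<Sum>j\<le>i. coeff (char_poly M) (n - i + j) * mat_trace (M ^\<^sub>m j))"
proof -
  define A where "A = char_poly_matrix M"
  define J where "J = adj_mat A"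
  \<comment> \<open>\<open>B m\<close> is the coefficient of t^m in t * adj (t - M). The shift by
    one gives \<open>B 0 = 0\<close> and makes the recursion below uniform in
    \<open>m\<close>.\<close>
  define B where "B m = map_mat (\<lambda>p. coeff (pCons 0 p) m) J" for m
  let ?\<chi> = "char_poly M"
  have A: "A \<in> carrier_mat n n" using M by (simp add: A_def)
  have J: "J \<in> carrier_mat n n" using adj_mat(1)[OF A] by (simp add: J_def)
  have B: "B m \<in> carrier_mat n n" for m using J by (simp add: B_def)
  have AJ: "A * J = ?\<chi> \<cdot>\<^sub>m 1\<^sub>m n"
    using adj_mat(2)[OF A] by (simp add: J_def A_def char_poly_def)
  \<comment> \<open>Coefficients of \<open>(t - M) adj (t - M) = \<chi>(t)\<close>.\<close>
  have B_step: "B m = M * B (Suc m) + coeff ?\<chi> m \<cdot>\<^sub>m 1\<^sub>m n" for m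
  proof (rule eq_matI)
    fix r s assume "r < dim_row (M * B (Suc m) + coeff ?\<chi> m \<cdot>\<^sub>m 1\<^sub>m n)"
      "s < dim_col (M * B (Suc m) + coeff ?\<chi> m \<cdot>\<^sub>m 1\<^sub>m n)"
    hence rs: "r < n" "s < n" using B by auto
    have "?\<chi> * (if r = s then 1 else 0) = (A * J) $$ (r, s)" using AJ rs by auto
    also have "\<dots> = (\<Sum>l<n. A $$ (r, l) * J $$ (l, s))"
      using A J rs by (simp add: scalar_prod_def atLeast0LessThan)
    also have "\<dots> = (\<Sum>l<n. (if r = l then pCons 0 (J $$ (l, s)) else 0) - smult (M $$ (r, l)) (J $$ (l, s)))"
      using M rs by (intro sum.cong) (auto simp: A_def char_poly_matrix_def algebra_simps)
    also have "\<dots> = pCons 0 (J $$ (r, s)) - (\<Sum>l<n. smult (M $$ (r, l)) (J $$ (l, s)))"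
      using rs by (simp add: sum_subtractf)
    finally have "coeff (pCons 0 (J $$ (r, s))) m
        = coeff (?\<chi> * (if r = s then 1 else 0)) m + (\<Sum>l<n. M $$ (r, l) * coeff (J $$ (l, s)) m)"
      by (simp add: coeff_sum)
    thus "B m $$ (r, s) = (M * B (Suc m) + coeff ?\<chi> m \<cdot>\<^sub>m 1\<^sub>m n) $$ (r, s)"
      using rs M J by (auto simp: B_def scalar_prod_def atLeast0LessThan)
  qed (use M B in auto)
  have deg: "degree (J $$ (r, s)) < n" if "r < n" "s < n" for r s
  proof -
    have "degree (det (mat_delete A s r)) \<le> 1 * (n - 1)"
    proof (rule degree_det_le[OF _ mat_delete_carrier[OF A]])
      fix a b assume "a < n - 1" "b < n - 1"
      thus "degree (mat_delete A s r $$ (a, b)) \<le> 1"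
        using M by (auto simp: mat_delete_def A_def char_poly_matrix_def)
    qed
    moreover have "J $$ (r, s) = (-1) ^ (s + r) * det (mat_delete A s r)"
      using A that by (simp add: J_def adj_mat_def cofactor_def)
    moreover have "degree ((-1) ^ (s + r) * det (mat_delete A s r)) = degree (det (mat_delete A s r))"
      by (cases "even (s + r)") auto
    ultimately show ?thesis using that by simp
  qed
  \<comment> \<open>The adjugate has entries of degree below n, so the recursion starts from zero at
    the top.\<close>
  have B_top: "B (Suc n) = 0\<^sub>m n n"
    using J deg by (intro eq_matI) (auto simp: B_def intro: coeff_eq_0)
  \<comment> \<open>The diagonal cofactors are the characteristic polynomials of the principal
    minors, and these add up to the derivative of chi.\<close>
  have "(\<Sum>l<n. J $$ (l, l)) = (\<Sum>l<n. char_poly (mat_delete M l l))"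
    using carrier_matD[OF A[unfolded A_def]] M by (intro sum.cong)
      (simp_all add: J_def adj_mat_def cofactor_def char_poly_def A_def char_poly_matrix_mat_delete[of _ n])
  hence "(\<Sum>l<n. J $$ (l, l)) = pderiv ?\<chi>" using pderiv_char_poly[OF M] by simp
  hence tr: "mat_trace (B m) = of_nat m * coeff ?\<chi> m" for m
    using J by (cases m) (auto simp: mat_trace_def B_def coeff_pderiv simp flip: coeff_sum)
  have pow: "M ^\<^sub>m e \<in> carrier_mat n n" for e using M by simp
  have tr_step: "mat_trace (M ^\<^sub>m e * B m)
      = mat_trace (M ^\<^sub>m Suc e * B (Suc m)) + coeff ?\<chi> m * mat_trace (M ^\<^sub>m e)" for e m
  proof -
    have "M ^\<^sub>m e * B m = M ^\<^sub>m e * (M * B (Suc m)) + M ^\<^sub>m e * (coeff ?\<chi> m \<cdot>\<^sub>m 1\<^sub>m n)"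
      unfolding B_step[of m]
      by (rule mult_add_distrib_mat[OF pow mult_carrier_mat[OF M B] smult_carrier_mat[OF one_carrier_mat]])
    also have "M ^\<^sub>m e * (M * B (Suc m)) = M ^\<^sub>m Suc e * B (Suc m)"
      by simp (metis assoc_mult_mat[OF pow M B])
    also have "M ^\<^sub>m e * (coeff ?\<chi> m \<cdot>\<^sub>m 1\<^sub>m n) = coeff ?\<chi> m \<cdot>\<^sub>m M ^\<^sub>m e"
      using mult_smult_distrib[OF pow one_carrier_mat] right_mult_one_mat[OF pow] by simp
    finally show ?thesis
      using mat_trace_add[of "M ^\<^sub>m Suc e * B (Suc m)" n "coeff ?\<chi> m \<cdot>\<^sub>m M ^\<^sub>m e"]
        mat_trace_smult[OF pow] B M pow by (metis mult_carrier_mat smult_carrier_mat)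
  qed
  \<comment> \<open>Each use of the recursion raises the index of \<open>B\<close> and adds one
    factor \<open>M\<close>, so the induction needs a general exponent \<open>e\<close>; only
    \<open>e = 0\<close> is wanted.\<close>
  have "mat_trace (M ^\<^sub>m e * B (n - i))
      = (\<Sum>j\<le>i. coeff ?\<chi> (n - i + j) * mat_trace (M ^\<^sub>m (e + j)))" for e
    using \<open>i \<le> n\<close>
  proof (induction i arbitrary: e)
    case 0
    show ?case using tr_step[of e n] B_top right_mult_zero_mat[OF pow[of "Suc e"]] mat_trace_zero by simp
  next
    case (Suc i)
    hence "Suc (n - Suc i) = n - i" by simp
    with tr_step[of e "n - Suc i"] Suc.IH[of "Suc e"] Suc.prems
    show ?case by (simp add: sum.atMost_Suc_shift del: sum.atMost_Suc)
  qed
  from this[of 0] show ?thesis using tr[of "n - i"] M left_mult_one_mat[OF B] by simp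
qed

section \<open>Companion matrices and block matrices\<close>

text \<open>Column convention: basis vector i goes to basis vector i + 1 and the last one to
  \<open>c\<close>, as the vectors v, M v, ... do. The characteristic polynomial is t^d - sum c_i
  t^i.\<close>

definition companion_mat :: "'a::zero_neq_one vec \<Rightarrow> 'a mat" where
  "companion_mat c = mat (dim_vec c) (dim_vec c)
     (\<lambda>(i, j). if Suc j = dim_vec c then c $ i else if i = Suc j then 1 else 0)"

lemma companion_mat_carrier [simp]:
  "c \<in> carrier_vec d \<Longrightarrow> companion_mat c \<in> carrier_mat d d"
  "dim_row (companion_mat c) = dim_vec c" "dim_col (companion_mat c) = dim_vec c"
  by (auto simp: companion_mat_def)

text \<open>Laplace expansion along row 0. One surviving minor is the smaller companion determinant;
  the other is triangular with diagonal -1, and the cofactor sign cancels its determinant.\<close>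

lemma char_poly_companion_mat_vCons:
  fixes c :: "'a::comm_ring_1 vec"
  shows "char_poly (companion_mat (vCons a c)) = pCons (- a) (char_poly (companion_mat c))"
proof -
  define d where "d = dim_vec c"
  define A where "A = char_poly_matrix (companion_mat (vCons a c))"
  have A: "A \<in> carrier_mat (Suc d) (Suc d)"
    by (simp add: A_def d_def)
  have entry: "A $$ (i, j) = (if i = j then [:0, 1:] else 0)
      - [: if j = d then vCons a c $ i else if i = Suc j then 1 else 0 :]" if "i \<le> d" "j \<le> d" for i j
    using that by (auto simp: A_def d_def char_poly_matrix_def companion_mat_def one_pCons)
  have "mat_delete A 0 0 = char_poly_matrix (companion_mat c)"
    by (intro eq_matI)
      (auto simp: A_def d_def char_poly_matrix_def companion_mat_def mat_delete_def)
  hence c0: "cofactor A 0 0 = char_poly (companion_mat c)"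
    by (simp add: cofactor_def char_poly_def)
  have cd: "cofactor A 0 d = 1"
  proof -
    have T: "mat_delete A 0 d \<in> carrier_mat d d" using mat_delete_carrier[OF A] by simp
    have "upper_triangular (mat_delete A 0 d)"
      using A by (auto simp: upper_triangular_def mat_delete_def entry)
    hence "det (mat_delete A 0 d) = prod_list (diag_mat (mat_delete A 0 d))"
      using det_upper_triangular T by blast
    also have "diag_mat (mat_delete A 0 d) = map (\<lambda>i. -1) [0..<d]"
      using A unfolding diag_mat_def
      by (auto simp: mat_delete_def entry one_pCons intro!: map_cong)
    also have "prod_list \<dots> = (-1) ^ d"
      by (induction d) auto
    finally show ?thesis by (simp add: cofactor_def flip: power_mult_distrib)
  qed
  have "char_poly (companion_mat (vCons a c)) = (\<Sum>j<Suc d. A $$ (0, j) * cofactor A 0 j)"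
    unfolding char_poly_def A_def[symmetric] by (rule laplace_expansion_row[OF A]) simp
  \<comment> \<open>Two separate indicators also cover d = 0, where columns 0 and d coincide and
    both contributions fall on one entry.\<close>
  also have "\<dots> = (\<Sum>j<Suc d. (if j = 0 then [:0, 1:] * cofactor A 0 j else 0)
      + (if j = d then - [:a:] * cofactor A 0 j else 0))"
    by (intro sum.cong) (auto simp: entry algebra_simps)
  also have "\<dots> = [:0, 1:] * cofactor A 0 0 - [:a:] * cofactor A 0 d"
    by (simp add: sum.distrib del: sum.lessThan_Suc)
  finally show ?thesis by (simp add: c0 cd)
qed

lemma coeff_char_poly_companion_mat:
  fixes c :: "'a::comm_ring_1 vec"
  assumes "i < dim_vec c"
  shows "coeff (char_poly (companion_mat c)) i = - c $ i"
  using assms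
proof (induction "dim_vec c" arbitrary: c i)
  case (Suc d)
  then obtain a c' where c: "c = vCons a c'" by (cases c) auto
  with Suc show ?case
    by (cases i) (auto simp: char_poly_companion_mat_vCons)
qed simp

text \<open>Turns a count of companion blocks into a count of monic polynomials, including d = 0
  with the empty block and the polynomial 1.\<close>

lemma bij_betw_char_poly_companion_mat:
  "bij_betw (\<lambda>c :: 'a::comm_ring_1 vec. char_poly (companion_mat c)) (carrier_vec d)
     {g. degree g = d \<and> coeff g d = 1}"
proof (rule bij_betwI[where g = "\<lambda>g. vec d (\<lambda>i. - coeff g i)"])
  show "(\<lambda>c. char_poly (companion_mat c)) \<in> carrier_vec d \<rightarrow> {g. degree g = d \<and> coeff g d = 1}"
    using degree_monic_char_poly companion_mat_carrier(1) by blast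
  show "char_poly (companion_mat (vec d (\<lambda>i. - coeff g i))) = g"
    if "g \<in> {g :: 'a poly. degree g = d \<and> coeff g d = 1}" for g
  proof (rule poly_eqI)
    fix i
    let ?h = "char_poly (companion_mat (vec d (\<lambda>i. - coeff g i)))"
    have "degree ?h = d \<and> coeff ?h d = 1"
      by (rule degree_monic_char_poly) simp
    with that show "coeff ?h i = coeff g i"
      by (cases i d rule: linorder_cases) (auto simp: coeff_char_poly_companion_mat coeff_eq_0)
  qed
qed (auto simp: coeff_char_poly_companion_mat)

lemma char_poly_four_block_lower_left_zero:
  fixes A :: "'a::idom mat"
  assumes A: "A \<in> carrier_mat n n" and B: "B \<in> carrier_mat n m" and D: "D \<in> carrier_mat m m"
  shows "char_poly (four_block_mat A B (0\<^sub>m m n) D) = char_poly A * char_poly D"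
proof -
  have "char_poly_matrix (four_block_mat A B (0\<^sub>m m n) D) = four_block_mat (char_poly_matrix A)
      (map_mat (\<lambda>a. [:- a:]) B) (0\<^sub>m m n) (char_poly_matrix D)"
    using A B D by (intro eq_matI) (auto simp: char_poly_matrix_def)
  thus ?thesis
    using A B D unfolding char_poly_def
    by (simp add: det_four_block_mat_lower_left_zero[OF _ _ refl])
qed

lemma four_block_mat_inject:
  assumes "A \<in> carrier_mat n1 m1" "B \<in> carrier_mat n1 m2" "C \<in> carrier_mat n2 m1" "D \<in> carrier_mat n2 m2"
    and "A' \<in> carrier_mat n1 m1" "B' \<in> carrier_mat n1 m2" "C' \<in> carrier_mat n2 m1" "D' \<in> carrier_mat n2 m2"
    and eq: "four_block_mat A B C D = four_block_mat A' B' C' D'"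
  shows "A = A' \<and> B = B' \<and> C = C' \<and> D = D'"
proof (intro conjI eq_matI)
  note e = arg_cong[OF eq, of "\<lambda>X. X $$ ij" for ij]
  show "A $$ (i, j) = A' $$ (i, j)" if "i < dim_row A'" "j < dim_col A'" for i j
    using e[of "(i, j)"] that assms(1-8) by auto
  show "B $$ (i, j) = B' $$ (i, j)" if "i < dim_row B'" "j < dim_col B'" for i j
    using e[of "(i, j + m1)"] that assms(1-8) by auto
  show "C $$ (i, j) = C' $$ (i, j)" if "i < dim_row C'" "j < dim_col C'" for i j
    using e[of "(i + n1, j)"] that assms(1-8) by auto
  show "D $$ (i, j) = D' $$ (i, j)" if "i < dim_row D'" "j < dim_col D'" for i j
    using e[of "(i + n1, j + m1)"] that assms(1-8) by auto
qed (use assms(1-8) in auto)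

section \<open>Invertible matrices\<close>

definition GL_mat :: "nat \<Rightarrow> 'a::field mat set" where
  "GL_mat n = {M \<in> carrier_mat n n. det M \<noteq> 0}"

lemma GL_mat_inverse:
  fixes P :: "'a::field mat"
  assumes "P \<in> GL_mat n"
  obtains Q where "Q \<in> GL_mat n" "P * Q = 1\<^sub>m n" "Q * P = 1\<^sub>m n"
proof -
  have P: "P \<in> carrier_mat n n" "det P \<noteq> 0" using assms by (auto simp: GL_mat_def)
  obtain Q where Q: "Q \<in> carrier_mat n n" "P * Q = 1\<^sub>m n" "Q * P = 1\<^sub>m n"
    using det_non_zero_imp_unit[OF P, of undefined]
    by (auto simp: Units_def ring_mat_def)
  have "det P * det Q = 1" using det_mult[OF P(1) Q(1)] Q(2) by simp
  hence "Q \<in> GL_mat n" using Q(1) by (auto simp: GL_mat_def)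
  with Q(2,3) that show thesis by blast
qed

lemma GL_mat_mult:
  fixes P :: "'a::field mat"
  shows "P \<in> GL_mat n \<Longrightarrow> Q \<in> GL_mat n \<Longrightarrow> P * Q \<in> GL_mat n"
  by (auto simp: GL_mat_def det_mult)

lemma mult_mat_vec_eq_if_cols_eq:
  fixes P :: "'a::comm_ring_1 mat"
  assumes "P \<in> carrier_mat n (d + e)" "P' \<in> carrier_mat n (d + e)" "c \<in> carrier_vec d"
    and "\<And>i. i < d \<Longrightarrow> col P i = col P' i"
  shows "P *\<^sub>v (c @\<^sub>v 0\<^sub>v e) = P' *\<^sub>v (c @\<^sub>v 0\<^sub>v e)"
proof (rule eq_vecI)
  fix i assume i: "i < dim_vec (P' *\<^sub>v (c @\<^sub>v 0\<^sub>v e))"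
  have "P $$ (i, j) = P' $$ (i, j)" if "j < d" for j
    using assms(4)[OF that] assms(1,2) i that by (metis index_col carrier_matD dim_mult_mat_vec trans_less_add1)
  hence "(\<Sum>j = 0..<d + e. P $$ (i, j) * (c @\<^sub>v 0\<^sub>v e) $ j) = (\<Sum>j = 0..<d + e. P' $$ (i, j) * (c @\<^sub>v 0\<^sub>v e) $ j)"
    using assms(3) by (intro sum.cong) auto
  thus "(P *\<^sub>v (c @\<^sub>v 0\<^sub>v e)) $ i = (P' *\<^sub>v (c @\<^sub>v 0\<^sub>v e)) $ i"
    using assms(1-3) i by (auto simp: scalar_prod_def)
qed (use assms in auto)

section \<open>Frames adapted to a cyclic subspace\<close>

lemma mult_mat_unit_vec:
  fixes A :: "'a::comm_ring_1 mat"
  assumes "A \<in> carrier_mat n m" "i < m"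
  shows "A *\<^sub>v unit_vec m i = col A i"
  using assms by (intro eq_vecI) auto

lemma four_block_mat_if_cols:
  assumes X: "X \<in> carrier_mat (d + e) (d + e)" and A: "A \<in> carrier_mat d d"
    and cols: "\<And>i. i < d \<Longrightarrow> col X i = col A i @\<^sub>v 0\<^sub>v e"
  obtains B D where "B \<in> carrier_mat d e" "D \<in> carrier_mat e e"
    "X = four_block_mat A B (0\<^sub>m e d) D"
proof
  let ?B = "mat d e (\<lambda>(i, j). X $$ (i, j + d))" and ?D = "mat e e (\<lambda>(i, j). X $$ (i + d, j + d))"
  show "?B \<in> carrier_mat d e" "?D \<in> carrier_mat e e" by auto
  have left: "X $$ (i, j) = (if i < d then A $$ (i, j) else 0)" if "j < d" "i < d + e" for i j
    using arg_cong[OF cols[OF that(1)], of "\<lambda>c. c $ i"] X A that by auto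
  show "X = four_block_mat A ?B (0\<^sub>m e d) ?D"
    using X A left by (intro eq_matI) auto
qed

text \<open>The invertible matrices whose first \<open>d\<close> columns are \<open>v, M v, \<dots>, M^(d-1) v\<close>; there are none
  unless \<open>d\<close> is the dimension of the cyclic subspace generated by \<open>v\<close>, as \<open>M^d v\<close> is required to lie in
  the span of these columns.\<close>

definition krylov_frames :: "nat \<Rightarrow> nat \<Rightarrow> 'a::field mat \<Rightarrow> 'a vec \<Rightarrow> 'a mat set" where
  "krylov_frames d e M v = {P \<in> GL_mat (d + e). (\<forall>i<d. col P i = (mult_mat_vec M ^^ i) v) \<and>
     (\<exists>c\<in>carrier_vec d. (mult_mat_vec M ^^ d) v = P *\<^sub>v (c @\<^sub>v 0\<^sub>v e))}"

lemma funpow_mult_mat_vec_carrier: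
  "M \<in> carrier_mat n n \<Longrightarrow> v \<in> carrier_vec n \<Longrightarrow> (mult_mat_vec M ^^ i) v \<in> carrier_vec n"
  by (induction i) auto

lemma col_mult_four_block_one:
  fixes P :: "'a::comm_ring_1 mat"
  assumes "P \<in> carrier_mat (d + e) (d + e)" "B \<in> carrier_mat d e" "D \<in> carrier_mat e e" "i < d"
  shows "col (P * four_block_mat (1\<^sub>m d) B (0\<^sub>m e d) D) i = col P i"
proof -
  have "col (four_block_mat (1\<^sub>m d) B (0\<^sub>m e d) D) i = unit_vec (d + e) i"
    using assms(4) by (subst col_four_block_mat[OF one_carrier_mat assms(2) zero_carrier_mat assms(3)])
      (auto intro!: eq_vecI)
  thus ?thesis
    using assms mult_mat_unit_vec[OF assms(1), of i]
    by (subst col_mult2[OF assms(1) four_block_carrier_mat[OF one_carrier_mat assms(3)]]) auto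
qed

text \<open>Two invertible matrices share their first d columns exactly when P^(-1) P' fixes the
  first d unit vectors, i.e. has this block form; it is invertible iff \<open>D\<close> is.\<close>

lemma bij_betw_GL_mat_same_cols:
  fixes P :: "'a::field mat"
  assumes P: "P \<in> GL_mat (d + e)"
  shows "bij_betw (\<lambda>(B, D). P * four_block_mat (1\<^sub>m d) B (0\<^sub>m e d) D) (carrier_mat d e \<times> GL_mat e)
    {P' \<in> GL_mat (d + e). \<forall>i<d. col P' i = col P i}"
proof -
  obtain Q where Q: "Q \<in> GL_mat (d + e)" "P * Q = 1\<^sub>m (d + e)" "Q * P = 1\<^sub>m (d + e)"
    using GL_mat_inverse[OF P] .
  have Pc: "P \<in> carrier_mat (d + e) (d + e)" and Qc: "Q \<in> carrier_mat (d + e) (d + e)"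
    using P Q by (auto simp: GL_mat_def)
  let ?X = "\<lambda>B D. four_block_mat (1\<^sub>m d) B (0\<^sub>m e d) D"
  have Xc: "?X B D \<in> carrier_mat (d + e) (d + e)" if "D \<in> carrier_mat e e" for B and D :: "'a mat"
    using that by (intro four_block_carrier_mat) auto
  have QPX: "Q * (P * X) = X" "P * (Q * X) = X" if "X \<in> carrier_mat (d + e) (d + e)" for X
    using assoc_mult_mat[OF Qc Pc that] assoc_mult_mat[OF Pc Qc that] Q that by auto
  have detX: "det (?X B D) = det D" if "B \<in> carrier_mat d e" "D \<in> carrier_mat e e" for B D :: "'a mat"
    using det_four_block_mat_lower_left_zero[OF one_carrier_mat that(1) refl that(2)] by simp
  show ?thesis unfolding bij_betw_def
  proof (intro conjI inj_onI equalityI subsetI)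
    fix x y assume x: "x \<in> carrier_mat d e \<times> GL_mat e" and y: "y \<in> carrier_mat d e \<times> GL_mat e"
      and eq: "(case x of (B, D) \<Rightarrow> P * ?X B D) = (case y of (B, D) \<Rightarrow> P * ?X B D)"
    obtain B D where xe: "x = (B, D)" by (cases x)
    obtain B' D' where ye: "y = (B', D')" by (cases y)
    have c: "B \<in> carrier_mat d e" "D \<in> carrier_mat e e" "B' \<in> carrier_mat d e" "D' \<in> carrier_mat e e"
      using x y by (auto simp: xe ye GL_mat_def)
    have "P * ?X B D = P * ?X B' D'" using eq by (simp add: xe ye)
    hence "Q * (P * ?X B D) = Q * (P * ?X B' D')" by (rule arg_cong)
    hence "?X B D = ?X B' D'" unfolding QPX(1)[OF Xc[OF c(2)]] QPX(1)[OF Xc[OF c(4)]] .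
    from four_block_mat_inject[OF one_carrier_mat c(1) zero_carrier_mat c(2)
        one_carrier_mat c(3) zero_carrier_mat c(4) this]
    show "x = y" by (simp add: xe ye)
  next
    fix P' assume "P' \<in> (\<lambda>(B, D). P * ?X B D) ` (carrier_mat d e \<times> GL_mat e)"
    then obtain B D where BD: "B \<in> carrier_mat d e" "D \<in> GL_mat e" and P': "P' = P * ?X B D" by auto
    have "?X B D \<in> GL_mat (d + e)" using BD detX Xc by (auto simp: GL_mat_def)
    with BD P' Pc GL_mat_mult[OF P] show "P' \<in> {P' \<in> GL_mat (d + e). \<forall>i<d. col P' i = col P i}"
      using col_mult_four_block_one[OF Pc] by (auto simp: GL_mat_def)
  next
    fix P' assume "P' \<in> {P' \<in> GL_mat (d + e). \<forall>i<d. col P' i = col P i}"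
    hence P': "P' \<in> GL_mat (d + e)" "\<And>i. i < d \<Longrightarrow> col P' i = col P i" by auto
    hence P'c: "P' \<in> carrier_mat (d + e) (d + e)" by (simp add: GL_mat_def)
    have QP': "Q * P' \<in> GL_mat (d + e)" using GL_mat_mult Q(1) P'(1) by blast
    hence QP'c: "Q * P' \<in> carrier_mat (d + e) (d + e)" by (simp add: GL_mat_def)
    have "col (Q * P') i = col (1\<^sub>m d) i @\<^sub>v 0\<^sub>v e" if "i < d" for i
    proof -
      have "col (Q * P') i = Q *\<^sub>v col P i" using that P'(2) Qc P'c by (subst col_mult2[OF Qc P'c]) auto
      also have "\<dots> = col (Q * P) i" using that by (subst col_mult2[OF Qc Pc]) auto
      finally show ?thesis using that by (auto simp: Q(3) intro!: eq_vecI)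
    qed
    from four_block_mat_if_cols[OF QP'c one_carrier_mat this]
    obtain B D where BD: "B \<in> carrier_mat d e" "D \<in> carrier_mat e e" "Q * P' = ?X B D" by metis
    moreover have "D \<in> GL_mat e" using BD detX QP' by (auto simp: GL_mat_def)
    moreover have "P' = P * ?X B D" using QPX(2)[OF P'c] BD(3) by simp
    ultimately show "P' \<in> (\<lambda>(B, D). P * ?X B D) ` (carrier_mat d e \<times> GL_mat e)" by auto
  qed
qed

text \<open>The span condition on M^d v only involves the first d columns, so every other completion
  of these columns inherits it.\<close>

lemma krylov_frames_eq_same_cols:
  fixes P :: "'a::field mat"
  assumes "P \<in> krylov_frames d e M v"
  shows "krylov_frames d e M v = {P' \<in> GL_mat (d + e). \<forall>i<d. col P' i = col P i}"
proof -
  have "P' *\<^sub>v (c @\<^sub>v 0\<^sub>v e) = P *\<^sub>v (c @\<^sub>v 0\<^sub>v e)"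
    if "P' \<in> GL_mat (d + e)" "\<And>i. i < d \<Longrightarrow> col P' i = col P i" "c \<in> carrier_vec d" for P' c
  proof (rule mult_mat_vec_eq_if_cols_eq)
    show "P' \<in> carrier_mat (d + e) (d + e)" using that(1) by (simp add: GL_mat_def)
    show "P \<in> carrier_mat (d + e) (d + e)" using assms by (simp add: GL_mat_def krylov_frames_def)
  qed (use that in auto)
  note eq = this
  obtain c where c: "c \<in> carrier_vec d" "(mult_mat_vec M ^^ d) v = P *\<^sub>v (c @\<^sub>v 0\<^sub>v e)"
    and P: "\<And>i. i < d \<Longrightarrow> col P i = (mult_mat_vec M ^^ i) v"
    using assms by (auto simp: krylov_frames_def)
  show ?thesis
  proof (intro equalityI subsetI)
    fix P' assume "P' \<in> krylov_frames d e M v"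
    thus "P' \<in> {P' \<in> GL_mat (d + e). \<forall>i<d. col P' i = col P i}"
      using P by (simp add: krylov_frames_def)
  next
    fix P' assume P': "P' \<in> {P' \<in> GL_mat (d + e). \<forall>i<d. col P' i = col P i}"
    hence "(mult_mat_vec M ^^ d) v = P' *\<^sub>v (c @\<^sub>v 0\<^sub>v e)"
      using eq[of P' c] c by simp
    with P P' c(1) show "P' \<in> krylov_frames d e M v"
      by (auto simp: krylov_frames_def)
  qed
qed

text \<open>The number of frames is the same for all pairs that have one; this is what allows pairs
  to be counted through frames.\<close>

lemma card_krylov_frames:
  fixes M :: "'a::field mat"
  assumes "krylov_frames d e M v \<noteq> {}"
  shows "card (krylov_frames d e M v) = card (carrier_mat d e :: 'a mat set) * card (GL_mat e :: 'a mat set)"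
proof -
  obtain P where P: "P \<in> krylov_frames d e M v" using assms by auto
  hence "P \<in> GL_mat (d + e)" by (simp add: krylov_frames_def)
  from bij_betw_same_card[OF bij_betw_GL_mat_same_cols[OF this]]
  show ?thesis using krylov_frames_eq_same_cols[OF P] by (simp add: card_cartesian_product)
qed

text \<open>In the larger frame M^d v is itself a column, yet by the smaller frame it is a
  combination of the d columns before it, which invertibility of \<open>P'\<close> forbids.\<close>

lemma krylov_frames_disjoint:
  fixes M :: "'a::field mat"
  assumes P: "P \<in> krylov_frames d e M v" and P': "P' \<in> krylov_frames d' e' M v"
    and n: "d + e = d' + e'" and "d < d'"
  shows False
proof -
  let ?n = "d + e"
  obtain c where c: "c \<in> carrier_vec d" "(mult_mat_vec M ^^ d) v = P *\<^sub>v (c @\<^sub>v 0\<^sub>v e)"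
    using P by (auto simp: krylov_frames_def)
  have Pc: "P \<in> carrier_mat ?n ?n" and P'c: "P' \<in> carrier_mat ?n ?n" and P'G: "P' \<in> GL_mat ?n"
    using P P' n by (auto simp: krylov_frames_def GL_mat_def)
  have "P *\<^sub>v (c @\<^sub>v 0\<^sub>v e) = P' *\<^sub>v (c @\<^sub>v 0\<^sub>v e)"
    using P P' \<open>d < d'\<close> by (intro mult_mat_vec_eq_if_cols_eq[OF Pc P'c c(1)]) (auto simp: krylov_frames_def)
  moreover have "col P' d = (mult_mat_vec M ^^ d) v"
    using P' \<open>d < d'\<close> by (auto simp: krylov_frames_def)
  moreover have "d < ?n" using n \<open>d < d'\<close> by linarith
  ultimately have eq: "P' *\<^sub>v unit_vec ?n d = P' *\<^sub>v (c @\<^sub>v 0\<^sub>v e)"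
    using c(2) mult_mat_unit_vec[OF P'c] by simp
  obtain Q where Q: "Q \<in> GL_mat ?n" "Q * P' = 1\<^sub>m ?n" using GL_mat_inverse[OF P'G] by metis
  have w: "c @\<^sub>v 0\<^sub>v e \<in> carrier_vec ?n" using c(1) by simp
  have "unit_vec ?n d = c @\<^sub>v 0\<^sub>v e"
  proof -
    have Qc: "Q \<in> carrier_mat ?n ?n" using Q(1) by (simp add: GL_mat_def)
    have cancel: "Q *\<^sub>v (P' *\<^sub>v y) = y" if "y \<in> carrier_vec ?n" for y
      unfolding assoc_mult_mat_vec[OF Qc P'c that, symmetric] Q(2) using that by simp
    show ?thesis using arg_cong[OF eq, of "mult_mat_vec Q"] cancel[OF w] cancel[OF unit_vec_carrier] by simp
  qed
  hence "unit_vec ?n d $ d = (c @\<^sub>v 0\<^sub>v e) $ d" by simp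
  with \<open>d < ?n\<close> c(1) show False by auto
qed

text \<open>Steinitz exchange: choose d maximal such that the first d iterates are columns of an
  invertible matrix. Then M^d v must lie in their span.\<close>

lemma krylov_frames_exist:
  fixes M :: "'a::field mat"
  assumes M: "M \<in> carrier_mat n n" and v: "v \<in> carrier_vec n"
  shows "\<exists>d\<le>n. krylov_frames d (n - d) M v \<noteq> {}"
proof -
  let ?k = "\<lambda>i. (mult_mat_vec M ^^ i) v"
  define S where "S = {d. d \<le> n \<and> (\<exists>P\<in>GL_mat n. \<forall>i<d. col P i = ?k i)}"
  have "1\<^sub>m n \<in> GL_mat n" by (simp add: GL_mat_def)
  hence "0 \<in> S" by (auto simp: S_def)
  moreover have "finite S" by (rule finite_subset[of _ "{..n}"]) (auto simp: S_def)
  ultimately have max: "Max S \<in> S" "\<And>d. d \<in> S \<Longrightarrow> d \<le> Max S" by (auto intro: Max_in)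
  define d where "d = Max S"
  obtain P where P: "P \<in> GL_mat n" "\<And>i. i < d \<Longrightarrow> col P i = ?k i" and "d \<le> n"
    using max(1) by (auto simp: S_def d_def)
  have Pc: "P \<in> carrier_mat n n" and detP: "det P \<noteq> 0" using P(1) by (auto simp: GL_mat_def)
  obtain Q where Q: "Q \<in> GL_mat n" "P * Q = 1\<^sub>m n" using GL_mat_inverse[OF P(1)] by metis
  have Qc: "Q \<in> carrier_mat n n" using Q by (simp add: GL_mat_def)
  define x where "x = Q *\<^sub>v ?k d"
  have kd: "?k d \<in> carrier_vec n" by (rule funpow_mult_mat_vec_carrier[OF M v])
  have x: "x \<in> carrier_vec n" using Qc kd by (simp add: x_def)
  have Px: "P *\<^sub>v x = ?k d"
    using assoc_mult_mat_vec[OF Pc Qc kd] Q(2) kd by (simp add: x_def)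
  have zero: "x $ j = 0" if j: "d \<le> j" "j < n" for j
  proof (rule ccontr)
    assume nz: "x $ j \<noteq> 0"
    \<comment> \<open>Then \<open>M^d v\<close> can be exchanged into column \<open>d\<close>, against maximality.\<close>
    define R where "R = replace_col P (P *\<^sub>v x) j"
    have Rc: "R \<in> carrier_mat n n" using Pc by (auto simp: R_def replace_col_def)
    \<comment> \<open>Cramer's rule: replacing column j by P x multiplies the determinant by
      \<open>x $ j\<close>.\<close>
    have detR: "det R \<noteq> 0" using cramer_lemma_mat[OF Pc x j(2)] nz detP by (simp add: R_def)
    \<comment> \<open>Moves the new column from j to d; as d <= j, the columns before d stay in
      place.\<close>
    define R' where "R' = (if j = d then R else swapcols d j R)"
    have R'c: "R' \<in> carrier_mat n n" using Rc by (simp add: R'_def)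
    have "det R' \<noteq> 0" using detR det_swapcols[of d n j R] Rc j by (auto simp: R'_def)
    moreover have "col R' i = ?k i" if "i < Suc d" for i
    proof (rule eq_vecI)
      have ki: "?k i \<in> carrier_vec n" by (rule funpow_mult_mat_vec_carrier[OF M v])
      then show "dim_vec (col R' i) = dim_vec (?k i)" using R'c by simp
      fix r assume "r < dim_vec (?k i)"
      hence r: "r < n" using ki by simp
      show "col R' i $ r = ?k i $ r"
      proof (cases "i = d")
        case True
        thus ?thesis using r j Rc Pc kd by (auto simp: R'_def R_def replace_col_def Px)
      next
        case False
        hence "i < d" using that by simp
        moreover from this have "col R' i $ r = col P i $ r"
          using False r j Rc Pc by (auto simp: R'_def R_def replace_col_def)
        ultimately show ?thesis using P(2) by simp
      qed
    qed
    moreover have "Suc d \<le> n" using j by simp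
    ultimately have "Suc d \<in> S" using R'c by (auto simp: S_def GL_mat_def)
    thus False using max(2) d_def by fastforce
  qed
  have "x = vec d (\<lambda>i. x $ i) @\<^sub>v 0\<^sub>v (n - d)"
    using x \<open>d \<le> n\<close> zero by (intro eq_vecI) auto
  hence "\<exists>c\<in>carrier_vec d. ?k d = P *\<^sub>v (c @\<^sub>v 0\<^sub>v (n - d))"
    using Px by (metis vec_carrier)
  with P \<open>d \<le> n\<close> have "P \<in> krylov_frames d (n - d) M v" by (auto simp: krylov_frames_def)
  with \<open>d \<le> n\<close> show ?thesis by auto
qed

section \<open>Counting matrices by characteristic polynomial\<close>

lemma finite_carrier_mat [simp]: "finite (carrier_mat n m :: 'a::finite mat set)"
proof (rule finite_surj)
  let ?I = "{..<n} \<times> {..<m}"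
  show "finite (PiE ?I (\<lambda>_. UNIV :: 'a set))" by (intro finite_PiE) auto
  show "carrier_mat n m \<subseteq> mat n m ` PiE ?I (\<lambda>_. UNIV :: 'a set)"
  proof
    fix M :: "'a mat" assume "M \<in> carrier_mat n m"
    hence "M = mat n m (restrict (($$) M) ?I)" by (intro eq_matI) auto
    moreover have "restrict (($$) M) ?I \<in> PiE ?I (\<lambda>_. UNIV)" by auto
    ultimately show "M \<in> mat n m ` PiE ?I (\<lambda>_. UNIV)" by blast
  qed
qed

lemma card_carrier_mat_pos: "card (carrier_mat n m :: 'a::{finite,zero} mat set) > 0"
  using zero_carrier_mat[of n m] by (auto simp: card_gt_0_iff)

lemma card_carrier_vec: "card (carrier_vec n :: 'a::finite vec set) = card (UNIV :: 'a set) ^ n"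
proof -
  have "bij_betw list_of_vec (carrier_vec n :: 'a vec set) {xs. set xs \<subseteq> UNIV \<and> length xs = n}"
    by (rule bij_betwI[where g = vec_of_list]) (auto simp: vec_list list_vec intro!: carrier_vecI)
  from bij_betw_same_card[OF this] show ?thesis
    using card_lists_length_eq[of "UNIV :: 'a set" n] by simp
qed

lemma finite_carrier_vec [simp]: "finite (carrier_vec n :: 'a::finite vec set)"
  by (rule card_ge_0_finite) (simp add: card_carrier_vec finite_UNIV_card_ge_0)

lemma finite_GL_mat [simp]: "finite (GL_mat n :: 'a::{field,finite} mat set)"
  by (rule finite_subset[OF _ finite_carrier_mat]) (auto simp: GL_mat_def)

lemma card_GL_mat_pos: "card (GL_mat n :: 'a::{field,finite} mat set) > 0"
proof -
  have "1\<^sub>m n \<in> (GL_mat n :: 'a mat set)" by (simp add: GL_mat_def)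
  thus ?thesis by (auto simp: card_gt_0_iff)
qed

lemma companion_block_mult_unit_vec:
  fixes c :: "'a::comm_ring_1 vec"
  assumes c: "c \<in> carrier_vec d" and B: "B \<in> carrier_mat d e" and D: "D \<in> carrier_mat e e" and "i < d"
  shows "four_block_mat (companion_mat c) B (0\<^sub>m e d) D *\<^sub>v unit_vec (d + e) i
    = (if Suc i = d then c @\<^sub>v 0\<^sub>v e else unit_vec (d + e) (Suc i))"
proof -
  have "four_block_mat (companion_mat c) B (0\<^sub>m e d) D *\<^sub>v unit_vec (d + e) i
      = col (four_block_mat (companion_mat c) B (0\<^sub>m e d) D) i"
    using \<open>i < d\<close>
    by (intro mult_mat_unit_vec[OF four_block_carrier_mat[OF companion_mat_carrier(1)[OF c] D]]) simp
  also have "\<dots> = col (companion_mat c) i @\<^sub>v col (0\<^sub>m e d) i"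
    by (rule col_four_block_mat(1)[OF companion_mat_carrier(1)[OF c] B zero_carrier_mat D \<open>i < d\<close>])
  also have "\<dots> = (if Suc i = d then c @\<^sub>v 0\<^sub>v e else unit_vec (d + e) (Suc i))"
    using c \<open>i < d\<close> by (intro eq_vecI) (auto simp: companion_mat_def)
  finally show ?thesis .
qed

text \<open>\<open>u\<close> is the cyclic vector of the companion block. For d = 0 the cyclic
  subspace is trivial, so \<open>u\<close> has to be the zero vector.\<close>

lemma companion_block_funpow:
  fixes c :: "'a::comm_ring_1 vec" and d e :: nat
  defines "u \<equiv> (if d = 0 then 0\<^sub>v (d + e) else unit_vec (d + e) 0)"
  assumes c: "c \<in> carrier_vec d" and B: "B \<in> carrier_mat d e" and D: "D \<in> carrier_mat e e"
  defines "A \<equiv> four_block_mat (companion_mat c) B (0\<^sub>m e d) D"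
  shows "i < d \<Longrightarrow> (mult_mat_vec A ^^ i) u = unit_vec (d + e) i"
    and "(mult_mat_vec A ^^ d) u = c @\<^sub>v 0\<^sub>v e"
proof -
  show *: "(mult_mat_vec A ^^ i) u = unit_vec (d + e) i" if "i < d" for i
    using that
  proof (induction i)
    case (Suc i)
    thus ?case using companion_block_mult_unit_vec[OF c B D, of i] by (simp add: A_def)
  qed (simp add: u_def)
  show "(mult_mat_vec A ^^ d) u = c @\<^sub>v 0\<^sub>v e"
  proof (cases d)
    case 0
    thus ?thesis using c by (auto simp: u_def)
  next
    case (Suc j)
    thus ?thesis using companion_block_mult_unit_vec[OF c B D, of j] *[of j] by (simp add: A_def)
  qed
qed

lemma funpow_mult_mat_vec_similar:
  fixes P :: "'a::comm_ring_1 mat"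
  assumes P: "P \<in> carrier_mat n n" and Q: "Q \<in> carrier_mat n n" and A: "A \<in> carrier_mat n n"
    and QP: "Q * P = 1\<^sub>m n" and u: "u \<in> carrier_vec n"
  shows "(mult_mat_vec (P * A * Q) ^^ i) (P *\<^sub>v u) = P *\<^sub>v ((mult_mat_vec A ^^ i) u)"
proof (induction i)
  case (Suc i)
  define w where "w = (mult_mat_vec A ^^ i) u"
  have w: "w \<in> carrier_vec n" unfolding w_def by (rule funpow_mult_mat_vec_carrier[OF A u])
  have "(P * A * Q) *\<^sub>v (P *\<^sub>v w) = P * A *\<^sub>v (Q *\<^sub>v (P *\<^sub>v w))"
    by (rule assoc_mult_mat_vec[OF mult_carrier_mat[OF P A] Q]) (use P w in simp)
  also have "Q *\<^sub>v (P *\<^sub>v w) = w"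
    unfolding assoc_mult_mat_vec[OF Q P w, symmetric] QP using w by simp
  also have "P * A *\<^sub>v w = P *\<^sub>v (A *\<^sub>v w)" by (rule assoc_mult_mat_vec[OF P A w])
  finally show ?case using Suc by (simp add: w_def)
qed simp

lemma mat_conjugate_cancel:
  fixes P :: "'a::comm_ring_1 mat"
  assumes P: "P \<in> carrier_mat n n" and Q: "Q \<in> carrier_mat n n" and A: "A \<in> carrier_mat n n"
    and QP: "Q * P = 1\<^sub>m n"
  shows "Q * (P * A * Q) * P = A"
proof -
  note PA = mult_carrier_mat[OF P A]
  have "Q * (P * A * Q) = Q * (P * A) * Q" by (rule assoc_mult_mat[OF Q PA Q, symmetric])
  also have "Q * (P * A) = A"
    unfolding assoc_mult_mat[OF Q P A, symmetric] QP using A by simp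
  finally have eq: "Q * (P * A * Q) = A * Q" .
  show ?thesis unfolding eq assoc_mult_mat[OF A Q P] QP using A by simp
qed

text \<open>Fixing the frame \<open>P\<close> determines \<open>v\<close>, and conjugation by
  \<open>P\<close> puts \<open>M\<close> into block form with a companion block. The upper right
  block does not affect the characteristic polynomial and gives the first factor; the companion
  block is traded for its characteristic polynomial \<open>g\<close>.\<close>

lemma card_krylov_frames_slice:
  fixes P :: "'a::{field,finite} mat"
  assumes P: "P \<in> GL_mat (d + e)"
  shows "card {(M, v). M \<in> carrier_mat (d + e) (d + e) \<and> v \<in> carrier_vec (d + e) \<and>
      char_poly M \<in> \<Phi> \<and> P \<in> krylov_frames d e M v}
    = card (carrier_mat d e :: 'a mat set) *
      (\<Sum>D\<in>carrier_mat e e. card {g. degree g = d \<and> coeff g d = 1 \<and> g * char_poly D \<in> \<Phi>})"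
    (is "card ?X = _")
proof -
  let ?n = "d + e"
  obtain Q where Q: "Q \<in> GL_mat ?n" "P * Q = 1\<^sub>m ?n" "Q * P = 1\<^sub>m ?n"
    using GL_mat_inverse[OF P] .
  have Pc: "P \<in> carrier_mat ?n ?n" and Qc: "Q \<in> carrier_mat ?n ?n"
    using P Q by (auto simp: GL_mat_def)
  define u :: "'a vec" where "u = (if d = 0 then 0\<^sub>v ?n else unit_vec ?n 0)"
  have u: "u \<in> carrier_vec ?n" by (simp add: u_def)
  let ?A = "\<lambda>c B D. four_block_mat (companion_mat c) B (0\<^sub>m e d) D"
  define Y where "Y = (carrier_mat d e :: 'a mat set) \<times>
    Sigma (carrier_mat e e) (\<lambda>D. {c \<in> carrier_vec d. char_poly (companion_mat c) * char_poly D \<in> \<Phi>})"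
  let ?f = "\<lambda>(B, D, c). (P * ?A c B D * Q, P *\<^sub>v u)"
  have Ac: "?A c B D \<in> carrier_mat ?n ?n" if "c \<in> carrier_vec d" "D \<in> carrier_mat e e" for c :: "'a vec" and B D
    by (rule four_block_carrier_mat[OF companion_mat_carrier(1)[OF that(1)] that(2)])
  have cancel: "Q * (P * A * Q) * P = A" "P * (Q * A * P) * Q = A" if "A \<in> carrier_mat ?n ?n" for A
    by (rule mat_conjugate_cancel; use Pc Qc Q that in simp)+
  have chi: "char_poly (P * A * Q) = char_poly A" if "A \<in> carrier_mat ?n ?n" for A
  proof (rule char_poly_similar)
    have "similar_mat_wit (P * A * Q) A P Q"
      using that Pc Qc Q(2,3) by (intro similar_mat_witI[of _ _ ?n]) auto
    thus "similar_mat (P * A * Q) A" by (auto simp: similar_mat_def)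
  qed
  have bij: "bij_betw ?f Y ?X" unfolding bij_betw_def
  proof (intro conjI inj_onI equalityI subsetI)
    fix x y assume "x \<in> Y" "y \<in> Y" and eq: "?f x = ?f y"
    obtain B D c where x: "x = (B, D, c)" by (cases x)
    obtain B' D' c' where y: "y = (B', D', c')" by (cases y)
    have c: "B \<in> carrier_mat d e" "D \<in> carrier_mat e e" "c \<in> carrier_vec d"
      and c': "B' \<in> carrier_mat d e" "D' \<in> carrier_mat e e" "c' \<in> carrier_vec d"
      using \<open>x \<in> Y\<close> \<open>y \<in> Y\<close> by (auto simp: Y_def x y)
    have "P * ?A c B D * Q = P * ?A c' B' D' * Q" using eq by (simp add: x y)
    hence "Q * (P * ?A c B D * Q) * P = Q * (P * ?A c' B' D' * Q) * P" by (rule arg_cong)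
    hence "?A c B D = ?A c' B' D'" unfolding cancel(1)[OF Ac[OF c(3,2)]] cancel(1)[OF Ac[OF c'(3,2)]] .
    from four_block_mat_inject[OF companion_mat_carrier(1)[OF c(3)] c(1) zero_carrier_mat c(2)
        companion_mat_carrier(1)[OF c'(3)] c'(1) zero_carrier_mat c'(2) this]
    have eqs: "companion_mat c = companion_mat c'" "B = B'" "D = D'" by auto
    from bij_betw_char_poly_companion_mat[of d] have "inj_on (\<lambda>c. char_poly (companion_mat c)) (carrier_vec d :: 'a vec set)"
      by (rule bij_betw_imp_inj_on)
    hence "c = c'" by (rule inj_onD) (use eqs c c' in auto)
    with eqs show "x = y" by (simp add: x y)
  next
    fix z assume "z \<in> ?f ` Y"
    then obtain B D c where z: "z = (P * ?A c B D * Q, P *\<^sub>v u)"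
      and c: "B \<in> carrier_mat d e" "D \<in> carrier_mat e e" "c \<in> carrier_vec d"
      and \<Phi>: "char_poly (companion_mat c) * char_poly D \<in> \<Phi>"
      by (auto simp: Y_def)
    note A = Ac[OF c(3,2), of B]
    have pow: "(mult_mat_vec (P * ?A c B D * Q) ^^ i) (P *\<^sub>v u) = P *\<^sub>v ((mult_mat_vec (?A c B D) ^^ i) u)" for i
      by (rule funpow_mult_mat_vec_similar[OF Pc Qc A Q(3) u])
    have "col P i = (mult_mat_vec (P * ?A c B D * Q) ^^ i) (P *\<^sub>v u)" if "i < d" for i
      unfolding pow unfolding u_def companion_block_funpow(1)[OF c(3,1,2) that]
      by (rule mult_mat_unit_vec[OF Pc, symmetric]) (use that in simp)
    moreover have "(mult_mat_vec (P * ?A c B D * Q) ^^ d) (P *\<^sub>v u) = P *\<^sub>v (c @\<^sub>v 0\<^sub>v e)"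
      unfolding pow unfolding u_def companion_block_funpow(2)[OF c(3,1,2)] ..
    ultimately have "P \<in> krylov_frames d e (P * ?A c B D * Q) (P *\<^sub>v u)"
      unfolding krylov_frames_def using P c(3) by blast
    moreover have "char_poly (P * ?A c B D * Q) \<in> \<Phi>"
      unfolding chi[OF A] char_poly_four_block_lower_left_zero[OF companion_mat_carrier(1)[OF c(3)] c(1,2)]
      by (rule \<Phi>)
    moreover have "P * ?A c B D * Q \<in> carrier_mat ?n ?n" "P *\<^sub>v u \<in> carrier_vec ?n"
      using Pc Qc A u by auto
    ultimately show "z \<in> ?X" by (simp add: z)
  next
    fix z assume "z \<in> ?X"
    then obtain M v where z: "z = (M, v)" and M: "M \<in> carrier_mat ?n ?n" and v: "v \<in> carrier_vec ?n"
      and \<Phi>: "char_poly M \<in> \<Phi>" and frame: "P \<in> krylov_frames d e M v" by auto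
    obtain c where c: "c \<in> carrier_vec d" "(mult_mat_vec M ^^ d) v = P *\<^sub>v (c @\<^sub>v 0\<^sub>v e)"
      and colP: "\<And>i. i < d \<Longrightarrow> col P i = (mult_mat_vec M ^^ i) v"
      using frame by (auto simp: krylov_frames_def)
    define A where "A = Q * M * P"
    have A: "A \<in> carrier_mat ?n ?n" using M Pc Qc by (auto simp: A_def)
    have M_eq: "M = P * A * Q" using cancel(2)[OF M] by (simp add: A_def)
    have QPw: "Q *\<^sub>v (P *\<^sub>v w) = w" if "w \<in> carrier_vec ?n" for w
      unfolding assoc_mult_mat_vec[OF Qc Pc that, symmetric] Q(3) using that by simp
    \<comment> \<open>In the basis \<open>P\<close>, \<open>M\<close> sends column i to column i +
      1, and the last of the first d columns to M^d v, whose coordinates are \<open>c\<close>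
      followed by zeros.\<close>
    have "col A i = col (companion_mat c) i @\<^sub>v 0\<^sub>v e" if "i < d" for i
    proof -
      have ci: "col P i \<in> carrier_vec ?n" by (rule carrier_vecI) (use Pc in simp)
      have "col A i = (Q * M) *\<^sub>v col P i"
        unfolding A_def using that by (intro col_mult2[OF mult_carrier_mat[OF Qc M] Pc]) simp
      also have "\<dots> = Q *\<^sub>v (M *\<^sub>v col P i)" by (rule assoc_mult_mat_vec[OF Qc M ci])
      also have "M *\<^sub>v col P i = (mult_mat_vec M ^^ Suc i) v" using colP[OF that] by simp
      also have "\<dots> = P *\<^sub>v (if Suc i = d then c @\<^sub>v 0\<^sub>v e else unit_vec ?n (Suc i))"
      proof (cases "Suc i = d")
        case True
        thus ?thesis using c(2) by (simp only: if_True refl)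
      next
        case False
        hence "Suc i < d" using that by simp
        from colP[OF this] show ?thesis
          using \<open>Suc i < d\<close> mult_mat_unit_vec[OF Pc, of "Suc i"]
          by (simp only: False if_False)
      qed
      also have "Q *\<^sub>v \<dots> = (if Suc i = d then c @\<^sub>v 0\<^sub>v e else unit_vec ?n (Suc i))"
        by (rule QPw) (use c(1) in simp)
      also have "\<dots> = col (companion_mat c) i @\<^sub>v 0\<^sub>v e"
        using c(1) that by (intro eq_vecI) (auto simp: companion_mat_def)
      finally show ?thesis .
    qed
    from four_block_mat_if_cols[OF A companion_mat_carrier(1)[OF c(1)] this]
    obtain B D where BD: "B \<in> carrier_mat d e" "D \<in> carrier_mat e e" "A = ?A c B D" by metis
    \<comment> \<open>For d = 0 no column records \<open>v\<close>; the span condition then says v =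
      0.\<close>
    have "v = P *\<^sub>v u"
    proof (cases "d = 0")
      case True
      have "c @\<^sub>v 0\<^sub>v e = 0\<^sub>v ?n" using c(1) True by (intro eq_vecI) auto
      thus ?thesis using c(2) True by (simp add: u_def)
    next
      case False
      thus ?thesis using colP[of 0] mult_mat_unit_vec[OF Pc, of 0] by (simp add: u_def)
    qed
    moreover have "char_poly M = char_poly (companion_mat c) * char_poly D"
      unfolding M_eq chi[OF A] unfolding BD(3)
      by (rule char_poly_four_block_lower_left_zero[OF companion_mat_carrier(1)[OF c(1)] BD(1,2)])
    ultimately have "z = ?f (B, D, c)" "(B, D, c) \<in> Y"
      using BD c(1) \<Phi> M_eq by (auto simp: z Y_def)
    thus "z \<in> ?f ` Y" by (rule image_eqI)
  qed
  have card_eq: "card {c \<in> carrier_vec d. char_poly (companion_mat c) * \<chi> \<in> \<Phi>}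
      = card {g. degree g = d \<and> coeff g d = 1 \<and> g * \<chi> \<in> \<Phi>}" for \<chi> :: "'a poly"
  proof (rule bij_betw_same_card[OF bij_betw_subset[OF bij_betw_char_poly_companion_mat[of d]]])
    let ?h = "\<lambda>c :: 'a vec. char_poly (companion_mat c)"
    have "?h ` {c \<in> carrier_vec d. ?h c * \<chi> \<in> \<Phi>} = {g \<in> ?h ` carrier_vec d. g * \<chi> \<in> \<Phi>}" by auto
    also have "\<dots> = {g. degree g = d \<and> coeff g d = 1 \<and> g * \<chi> \<in> \<Phi>}"
      unfolding bij_betw_imp_surj_on[OF bij_betw_char_poly_companion_mat[of d]] by auto
    finally show "?h ` {c \<in> carrier_vec d. ?h c * \<chi> \<in> \<Phi>}
        = {g. degree g = d \<and> coeff g d = 1 \<and> g * \<chi> \<in> \<Phi>}" .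
  qed auto
  have "card ?X = card Y" by (rule bij_betw_same_card[OF bij, symmetric])
  also have "\<dots> = card (carrier_mat d e :: 'a mat set) * (\<Sum>D\<in>carrier_mat e e.
      card {c \<in> carrier_vec d. char_poly (companion_mat c) * char_poly D \<in> \<Phi>})"
    by (simp add: Y_def card_cartesian_product)
  finally show ?thesis unfolding card_eq .
qed

text \<open>Double counting of triples (M, v, P) for each d: by pairs with the constant frame
  number, by frames with the slice count. The number of d x (n-d) blocks occurs on both sides and
  cancels, leaving the ratio of group orders.\<close>

lemma card_char_poly_in:
  fixes \<Phi> :: "'a::{field,finite} poly set"
  shows "real (card (UNIV :: 'a set)) ^ n * real (card {M \<in> carrier_mat n n. char_poly M \<in> \<Phi>})
    = (\<Sum>d\<le>n. real (card (GL_mat n :: 'a mat set)) / real (card (GL_mat (n - d) :: 'a mat set)) *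
        real (\<Sum>D\<in>carrier_mat (n - d) (n - d).
          card {g. degree g = d \<and> coeff g d = 1 \<and> g * char_poly D \<in> \<Phi>}))"
proof -
  let ?G = "\<lambda>n. card (GL_mat n :: 'a mat set)"
  define A where "A = {M \<in> carrier_mat n n. char_poly M \<in> \<Phi>} \<times> (carrier_vec n :: 'a vec set)"
  define X where "X d = {(M, v). (M, v) \<in> A \<and> krylov_frames d (n - d) M v \<noteq> {}}" for d
  define S where "S d = (\<Sum>D\<in>carrier_mat (n - d) (n - d).
    card {g. degree g = d \<and> coeff g d = 1 \<and> g * char_poly D \<in> \<Phi>})" for d
  have finA: "finite A" by (simp add: A_def)
  have finX: "finite (X d)" for d by (rule finite_subset[OF _ finA]) (auto simp: X_def)
  have A_eq: "A = (\<Union>d\<le>n. X d)"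
    using krylov_frames_exist by (auto simp: X_def A_def) blast
  have "X d \<inter> X d' = {}" if "d \<le> n" "d' \<le> n" "d < d'" for d d'
    using krylov_frames_disjoint[of _ d "n - d" _ _ _ d' "n - d'"] that by (auto simp: X_def)
  hence "X d \<inter> X d' = {}" if "d \<le> n" "d' \<le> n" "d \<noteq> d'" for d d'
    using that by (cases d d' rule: linorder_cases) (auto simp: Int_commute)
  hence card_A: "card A = (\<Sum>d\<le>n. card (X d))"
    unfolding A_eq using finX by (intro card_UN_disjoint) auto
  have count: "card (X d) * ?G (n - d) = ?G n * S d" if "d \<le> n" for d
  proof -
    let ?b = "card (carrier_mat d (n - d) :: 'a mat set)"
    have n: "d + (n - d) = n" using that by simp
    have "card (krylov_frames d (n - d) (fst z) (snd z)) = ?b * ?G (n - d)" if "z \<in> X d" for z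
      by (rule card_krylov_frames) (use that in \<open>auto simp: X_def\<close>)
    hence "card (X d) * (?b * ?G (n - d)) = (\<Sum>z\<in>X d. card (krylov_frames d (n - d) (fst z) (snd z)))"
      by simp
    also have "\<dots> = (\<Sum>z\<in>X d. \<Sum>P\<in>GL_mat n. if P \<in> krylov_frames d (n - d) (fst z) (snd z) then 1 else 0)"
    proof (rule sum.cong[OF refl])
      fix z :: "'a mat \<times> 'a vec"
      have "krylov_frames d (n - d) (fst z) (snd z) \<subseteq> GL_mat n"
        using n by (auto simp: krylov_frames_def)
      thus "card (krylov_frames d (n - d) (fst z) (snd z))
          = (\<Sum>P\<in>GL_mat n. if P \<in> krylov_frames d (n - d) (fst z) (snd z) then 1 else 0)"
        by (simp add: sum.If_cases Int_absorb1)
    qed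
    also have "\<dots> = (\<Sum>P\<in>GL_mat n. \<Sum>z\<in>X d. if P \<in> krylov_frames d (n - d) (fst z) (snd z) then 1 else 0)"
      by (rule sum.swap)
    also have "\<dots> = (\<Sum>P\<in>(GL_mat n :: 'a mat set). ?b * S d)"
    proof (rule sum.cong[OF refl])
      fix P :: "'a mat" assume "P \<in> GL_mat n"
      hence P: "P \<in> GL_mat (d + (n - d))" by (simp add: n)
      have "X d \<inter> {z. P \<in> krylov_frames d (n - d) (fst z) (snd z)} = {(M, v). M \<in> carrier_mat n n \<and>
          v \<in> carrier_vec n \<and> char_poly M \<in> \<Phi> \<and> P \<in> krylov_frames d (n - d) M v}"
        by (auto simp: X_def A_def)
      thus "(\<Sum>z\<in>X d. if P \<in> krylov_frames d (n - d) (fst z) (snd z) then 1 else 0) = ?b * S d"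
        using card_krylov_frames_slice[OF P, of \<Phi>] finX
        by (simp add: sum.If_cases n S_def)
    qed
    also have "\<dots> = ?b * (?G n * S d)" by simp
    finally have "?b * (card (X d) * ?G (n - d)) = ?b * (?G n * S d)" by (simp add: mult_ac)
    thus ?thesis using card_carrier_mat_pos[of d "n - d", where 'a = 'a] by auto
  qed
  have "real (card (UNIV :: 'a set)) ^ n * real (card {M \<in> carrier_mat n n. char_poly M \<in> \<Phi>}) = real (card A)"
    by (simp add: A_def card_cartesian_product card_carrier_vec)
  also have "\<dots> = (\<Sum>d\<le>n. real (card (X d)))" by (simp add: card_A)
  also have "\<dots> = (\<Sum>d\<le>n. real (?G n) / real (?G (n - d)) * real (S d))"
  proof (rule sum.cong[OF refl])
    fix d assume "d \<in> {..n}"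
    hence "real (card (X d)) * real (?G (n - d)) = real (?G n) * real (S d)"
      using count[of d] by (simp flip: of_nat_mult)
    moreover have "real (?G (n - d)) > 0"
      using card_GL_mat_pos[of "n - d", where 'a = 'a] by (simp only: of_nat_0_less_iff)
    moreover have "x = g / g' * s" if "x * g' = g * s" "g' > 0" for x g g' s :: real
      using that by (simp add: field_simps)
    ultimately show "real (card (X d)) = real (?G n) / real (?G (n - d)) * real (S d)" by blast
  qed
  finally show ?thesis by (simp only: S_def)
qed

section \<open>Multiples of a polynomial with prescribed leading coefficients\<close>

lemma card_monic_polys:
  "card {g :: 'a::{comm_ring_1,finite} poly. degree g = d \<and> coeff g d = 1} = card (UNIV :: 'a set) ^ d"
  using bij_betw_same_card[OF bij_betw_char_poly_companion_mat[of d, where 'a = 'a]]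
  by (simp add: card_carrier_vec)

lemma finite_monic_polys: "finite {g :: 'a::{comm_ring_1,finite} poly. degree g = d \<and> coeff g d = 1}"
  using bij_betw_finite[OF bij_betw_char_poly_companion_mat[of d, where 'a = 'a]] by simp

text \<open>Meant for h = chi_D, so that d + \<open>degree h\<close> = n and the index is counted
  down from the top coefficient; \<open>c0\<close> carries the determinant condition.\<close>

definition prefix_multiples :: "nat \<Rightarrow> nat \<Rightarrow> 'a::comm_ring_1 poly \<Rightarrow> (nat \<Rightarrow> 'a) \<Rightarrow> 'a \<Rightarrow> 'a poly set" where
  "prefix_multiples d k h c c0 = {g. degree g = d \<and> coeff g d = 1 \<and>
     (\<forall>i\<in>{1..k}. coeff (g * h) (d + degree h - i) = c i) \<and> coeff (g * h) 0 = c0}"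

lemma finite_prefix_multiples: "finite (prefix_multiples d k h c (c0 :: 'a::{comm_ring_1,finite}))"
  by (rule finite_subset[OF _ finite_monic_polys[of d]]) (auto simp: prefix_multiples_def)

text \<open>The products agree in their top coefficient and in the k below it, so (g - g') h loses
  more than k degrees, and hence so does g - g'. The constant terms agree because h(0) can be
  cancelled.\<close>

lemma prefix_multiples_diff:
  fixes h :: "'a::idom poly"
  assumes g: "g \<in> prefix_multiples d k h c c0" and g': "g' \<in> prefix_multiples d k h c c0"
    and h: "coeff h 0 \<noteq> 0"
  shows "g = g' \<or> degree (g - g') + k < d" and "coeff g 0 = coeff g' 0"
proof -
  have "coeff g 0 * coeff h 0 = coeff g' 0 * coeff h 0"
    using g g' by (simp add: prefix_multiples_def coeff_mult)
  thus "coeff g 0 = coeff g' 0" using h by simp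
  have "h \<noteq> 0" using h by auto
  show "g = g' \<or> degree (g - g') + k < d"
  proof (rule disjCI)
    assume "\<not> degree (g - g') + k < d"
    hence le: "d + degree h - k \<le> degree (g - g') + degree h" by linarith
    show "g = g'"
    proof (rule ccontr)
      assume "g \<noteq> g'"
      hence "degree ((g - g') * h) = degree (g - g') + degree h"
        using \<open>h \<noteq> 0\<close> by (intro degree_mult_eq) auto
      moreover have "(g - g') * h \<noteq> 0" using \<open>g \<noteq> g'\<close> \<open>h \<noteq> 0\<close> by simp
      ultimately have nz: "coeff ((g - g') * h) (degree (g - g') + degree h) \<noteq> 0"
        by (metis leading_coeff_0_iff)
      \<comment> \<open>The distance from the top at which the leading term of (g - g') h sits. For
        i = 0 agreement comes from monicity, otherwise from the prescribed prefix.\<close>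
      define i where "i = d - degree (g - g')"
      have "degree (g - g') \<le> d" using g g' degree_diff_le[of g d g'] by (auto simp: prefix_multiples_def)
      hence idx: "degree (g - g') + degree h = d + degree h - i" "i \<le> k" using le
        by (auto simp: i_def)
      have "coeff (g * h) (d + degree h - i) = coeff (g' * h) (d + degree h - i)"
      proof (cases "i = 0")
        case True
        have "coeff (g * h) (degree g + degree h) = coeff (g' * h) (degree g' + degree h)"
          using g g' using coeff_mult_degree_sum[of g h] coeff_mult_degree_sum[of g' h]
          by (simp add: prefix_multiples_def)
        thus ?thesis using g g' True by (simp add: prefix_multiples_def)
      next
        case False
        hence "i \<in> {1..k}" using idx by simp
        thus ?thesis using g g' by (simp add: prefix_multiples_def)
      qed
      with nz idx show False by (simp add: left_diff_distrib)
    qed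
  qed
qed

lemma card_prefix_multiples_le_one:
  fixes h :: "'a::{idom,finite} poly"
  assumes h: "coeff h 0 \<noteq> 0" and "d \<le> k"
  shows "card (prefix_multiples d k h c c0) \<le> 1"
proof -
  have "g = g'" if "g \<in> prefix_multiples d k h c c0" "g' \<in> prefix_multiples d k h c c0" for g g'
    using prefix_multiples_diff(1)[OF that h] \<open>d \<le> k\<close> by auto
  thus ?thesis
    using card_le_Suc0_iff_eq[OF finite_prefix_multiples[of d k h c c0]] by simp
qed

lemma card_prefix_multiples_le:
  fixes h :: "'a::{idom,finite} poly"
  assumes h: "coeff h 0 \<noteq> 0" and "k < d"
  shows "card (prefix_multiples d k h c c0) \<le> card (UNIV :: 'a set) ^ (d - k - 1)"
proof -
  \<comment> \<open>The only free coefficients: two members agree at index 0 and at all indices from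
    d - k on.\<close>
  let ?I = "{1..<d - k}"
  have "inj_on (\<lambda>g. restrict (coeff g) ?I) (prefix_multiples d k h c c0)"
  proof (rule inj_onI)
    fix g g' assume g: "g \<in> prefix_multiples d k h c c0" "g' \<in> prefix_multiples d k h c c0"
      and eq: "restrict (coeff g) ?I = restrict (coeff g') ?I"
    show "g = g'"
    proof (rule ccontr)
      assume "g \<noteq> g'"
      with prefix_multiples_diff[OF g h] have deg: "degree (g - g') < d - k" and "coeff g 0 = coeff g' 0"
        by auto
      moreover have "coeff g i = coeff g' i" if "i \<in> ?I" for i
        using fun_cong[OF eq, of i] that by simp
      ultimately have "coeff (g - g') (degree (g - g')) = 0"
        by (cases "degree (g - g')") auto
      with \<open>g \<noteq> g'\<close> show False by (simp only: leading_coeff_0_iff) simp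
    qed
  qed
  moreover have "(\<lambda>g. restrict (coeff g) ?I) ` prefix_multiples d k h c c0 \<subseteq> PiE ?I (\<lambda>_. UNIV)" by auto
  moreover have "finite (PiE ?I (\<lambda>_. UNIV :: 'a set))" by (intro finite_PiE) auto
  ultimately have "card (prefix_multiples d k h c c0) \<le> card (PiE ?I (\<lambda>_. UNIV :: 'a set))"
    by (rule card_inj_on_le)
  also have "\<dots> = card (UNIV :: 'a set) ^ (d - k - 1)" by (simp add: card_PiE)
  finally show ?thesis .
qed

text \<open>Equality comes from a count, not from solving for \<open>g\<close>: the q^(k+1) choices
  of data partition the q^d monic polynomials, and each class has at most q^(d-k-1) members.\<close>

lemma card_prefix_multiples:
  fixes h :: "'a::{idom,finite} poly"
  assumes h: "coeff h 0 \<noteq> 0" and "k < d"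
  shows "card (prefix_multiples d k h c c0) = card (UNIV :: 'a set) ^ (d - k - 1)"
proof -
  let ?q = "card (UNIV :: 'a set)"
  define T where "T = PiE {1..k} (\<lambda>_. UNIV :: 'a set) \<times> (UNIV :: 'a set)"
  define F where "F t = prefix_multiples d k h (fst t) (snd t)" for t
  have finT: "finite T" unfolding T_def by (intro finite_cartesian_product finite_PiE) auto
  have card_T: "card T = ?q ^ k * ?q" by (simp add: T_def card_cartesian_product card_PiE)
  have "{g :: 'a poly. degree g = d \<and> coeff g d = 1} = (\<Union>t\<in>T. F t)"
  proof (intro equalityI subsetI)
    fix g :: "'a poly" assume "g \<in> {g. degree g = d \<and> coeff g d = 1}"
    hence "g \<in> F (restrict (\<lambda>i. coeff (g * h) (d + degree h - i)) {1..k}, coeff (g * h) 0)"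
      by (simp add: F_def prefix_multiples_def)
    thus "g \<in> (\<Union>t\<in>T. F t)" by (rule UN_I[rotated]) (auto simp: T_def)
  qed (auto simp: F_def prefix_multiples_def)
  moreover have "F t \<inter> F t' = {}" if "t \<in> T" "t' \<in> T" "t \<noteq> t'" for t t'
  proof (rule ccontr)
    assume "F t \<inter> F t' \<noteq> {}"
    then obtain g where g: "g \<in> F t" "g \<in> F t'" by auto
    have "fst t = fst t'"
      using that g by (intro PiE_ext[of _ "{1..k}" "\<lambda>_. UNIV"]) (auto simp: T_def F_def prefix_multiples_def)
    moreover have "snd t = snd t'" using g by (auto simp: F_def prefix_multiples_def)
    ultimately show False using that(3) by (simp add: prod_eq_iff)
  qed
  ultimately have "?q ^ d = (\<Sum>t\<in>T. card (F t))"
    using finT card_UN_disjoint[of T F] by (simp add: F_def finite_prefix_multiples flip: card_monic_polys)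
  also have "?q ^ d = ?q ^ (k + 1 + (d - k - 1))" using \<open>k < d\<close> by simp
  also have "\<dots> = (\<Sum>t\<in>T. ?q ^ (d - k - 1))" by (simp add: card_T power_add)
  finally have sum_eq: "(\<Sum>t\<in>T. ?q ^ (d - k - 1)) = (\<Sum>t\<in>T. card (F t))" .
  \<comment> \<open>No fibre exceeds the average size.\<close>
  have eq: "card (F t) = ?q ^ (d - k - 1)" if "t \<in> T" for t
  proof (rule ccontr)
    assume "card (F t) \<noteq> ?q ^ (d - k - 1)"
    hence "card (F t) < ?q ^ (d - k - 1)"
      using card_prefix_multiples_le[OF h \<open>k < d\<close>, of "fst t" "snd t"] by (simp add: F_def)
    hence "(\<Sum>t\<in>T. card (F t)) < (\<Sum>t\<in>T. ?q ^ (d - k - 1))"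
      using finT that card_prefix_multiples_le[OF h \<open>k < d\<close>]
      by (intro sum_strict_mono_ex1) (auto simp: F_def)
    thus False using sum_eq by simp
  qed
  have "prefix_multiples d k h c c0 = F (restrict c {1..k}, c0)"
    by (simp add: F_def prefix_multiples_def)
  thus ?thesis using eq[of "(restrict c {1..k}, c0)"] by (simp add: T_def)
qed

section \<open>Prefixes compatible with prescribed traces\<close>

text \<open>Newton's identities solved for the power sums, where \<open>c i\<close> stands for the coefficient of index
  \<open>n - i\<close> of a monic polynomial of degree \<open>n\<close>; the value \<open>c 0\<close> is not consulted.\<close>

fun newton_sum :: "(nat \<Rightarrow> 'a::comm_ring_1) \<Rightarrow> nat \<Rightarrow> 'a" where
  "newton_sum c i = - of_nat i * c i - (\<Sum>j\<in>{1..<i}. c (i - j) * newton_sum c j)"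

declare newton_sum.simps [simp del]

lemma newton_sum_cong:
  "(\<And>j. j \<in> {1..i} \<Longrightarrow> c j = c' j) \<Longrightarrow> newton_sum c i = newton_sum c' i"
proof (induction i rule: less_induct)
  case (less i)
  have "(\<Sum>j\<in>{1..<i}. c (i - j) * newton_sum c j) = (\<Sum>j\<in>{1..<i}. c' (i - j) * newton_sum c' j)"
    using less by (intro sum.cong) (auto intro!: arg_cong2[of _ _ _ _ "(*)"])
  moreover have "of_nat i * c i = of_nat i * c' i" using less.prems by (cases "i = 0") auto
  ultimately show ?case by (simp add: newton_sum.simps[of _ i])
qed

text \<open>In Newton's identity the term j = 0 is n c_i, which turns (n - i) c_i into - i c_i; the
  leading coefficient 1 isolates the trace of M^i.\<close>

lemma mat_trace_pow_eq_newton_sum: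
  fixes M :: "'a::idom mat"
  assumes M: "M \<in> carrier_mat n n" and "1 \<le> i" "i \<le> n"
  shows "mat_trace (M ^\<^sub>m i) = newton_sum (\<lambda>j. coeff (char_poly M) (n - j)) i"
  using assms(2,3)
proof (induction i rule: less_induct)
  case (less i)
  let ?c = "\<lambda>j. coeff (char_poly M) (n - j)"
  have c0: "?c 0 = 1" using degree_monic_char_poly[OF M] by simp
  have "of_nat (n - i) * ?c i = (\<Sum>j\<le>i. coeff (char_poly M) (n - i + j) * mat_trace (M ^\<^sub>m j))"
    using newton_char_poly[OF M less.prems(2)] .
  also have "\<dots> = (\<Sum>j\<le>i. ?c (i - j) * mat_trace (M ^\<^sub>m j))"
    using less.prems by (intro sum.cong) (auto intro!: arg_cong2[of _ _ _ _ "(*)"] arg_cong[of _ _ "coeff _"])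
  also have "{..i} = insert 0 (insert i {1..<i})" using less.prems by auto
  also have "(\<Sum>j\<in>insert 0 (insert i {1..<i}). ?c (i - j) * mat_trace (M ^\<^sub>m j))
      = ?c i * of_nat n + mat_trace (M ^\<^sub>m i) + (\<Sum>j\<in>{1..<i}. ?c (i - j) * mat_trace (M ^\<^sub>m j))"
    using less.prems M c0 by (simp add: mat_trace_one)
  also have "(\<Sum>j\<in>{1..<i}. ?c (i - j) * mat_trace (M ^\<^sub>m j)) = (\<Sum>j\<in>{1..<i}. ?c (i - j) * newton_sum ?c j)"
    using less by (intro sum.cong) auto
  finally have "mat_trace (M ^\<^sub>m i) = of_nat (n - i) * ?c i - ?c i * of_nat n
      - (\<Sum>j\<in>{1..<i}. ?c (i - j) * newton_sum ?c j)"
    by simp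
  also have "of_nat (n - i) * ?c i - ?c i * of_nat n = - of_nat i * ?c i"
    using less.prems by (simp add: of_nat_diff algebra_simps)
  finally show ?case by (simp only: newton_sum.simps[of _ i])
qed

text \<open>Prefixes are extensional, so distinct ones differ at an index in \<open>{1..k}\<close>:
  the set is finite and the events they define are disjoint.\<close>

definition trace_prefixes :: "nat \<Rightarrow> (nat \<Rightarrow> 'a::comm_ring_1) \<Rightarrow> nat \<Rightarrow> (nat \<Rightarrow> 'a) set" where
  "trace_prefixes p a k = {c \<in> PiE {1..k} (\<lambda>_. UNIV). \<forall>i\<in>{1..k}. \<not> p dvd i \<longrightarrow> newton_sum c i = a i}"

lemma finite_trace_prefixes: "finite (trace_prefixes p (a :: nat \<Rightarrow> 'a::{comm_ring_1,finite}) k)"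
  unfolding trace_prefixes_def by (rule finite_Collect_conjI) (auto intro: finite_PiE)

text \<open>The system is triangular: the i-th power sum is - i c_i plus an expression in earlier
  coefficients. If p does not divide i, this fixes c_i; otherwise no trace is prescribed and c_i is
  arbitrary.\<close>

lemma card_trace_prefixes:
  fixes a :: "nat \<Rightarrow> 'a::{field,finite}"
  assumes p: "\<And>i. of_nat i = (0 :: 'a) \<longleftrightarrow> p dvd i" and "p > 0"
  shows "card (trace_prefixes p a k) = card (UNIV :: 'a set) ^ (k div p)"
proof (induction k)
  case 0
  have "trace_prefixes p a 0 = {\<lambda>_. undefined}" by (auto simp: trace_prefixes_def)
  thus ?case by simp
next
  case (Suc k)
  let ?q = "card (UNIV :: 'a set)"
  define X where "X c = {x. p dvd Suc k \<or> newton_sum (c(Suc k := x)) (Suc k) = a (Suc k)}" for c :: "nat \<Rightarrow> 'a"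
  have upd: "newton_sum (c(Suc k := x)) i = newton_sum c i" if "i \<le> k" for c :: "nat \<Rightarrow> 'a" and x i
    using that by (intro newton_sum_cong) auto
  have "bij_betw (\<lambda>(c, x). c(Suc k := x)) (Sigma (trace_prefixes p a k) X) (trace_prefixes p a (Suc k))"
  proof (rule bij_betwI[where g = "\<lambda>c. (restrict c {1..k}, c (Suc k))"])
    show "(\<lambda>(c, x). c(Suc k := x)) \<in> Sigma (trace_prefixes p a k) X \<rightarrow> trace_prefixes p a (Suc k)"
      by (auto simp: trace_prefixes_def X_def upd le_Suc_eq PiE_iff extensional_def)
    show "(\<lambda>c. (restrict c {1..k}, c (Suc k))) \<in> trace_prefixes p a (Suc k) \<rightarrow> Sigma (trace_prefixes p a k) X"
    proof
      fix c assume c: "c \<in> trace_prefixes p a (Suc k)"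
      have "newton_sum (restrict c {1..k}) i = newton_sum c i" if "i \<le> k" for i
        using that by (intro newton_sum_cong) auto
      moreover have "newton_sum ((restrict c {1..k})(Suc k := c (Suc k))) (Suc k) = newton_sum c (Suc k)"
        by (intro newton_sum_cong) auto
      ultimately show "(restrict c {1..k}, c (Suc k)) \<in> Sigma (trace_prefixes p a k) X"
        using c by (auto simp: trace_prefixes_def X_def)
    qed
    show "(\<lambda>c. (restrict c {1..k}, c (Suc k))) ((\<lambda>(c, x). c(Suc k := x)) z) = z"
      if "z \<in> Sigma (trace_prefixes p a k) X" for z
      using that by (auto simp: trace_prefixes_def PiE_iff extensional_def fun_eq_iff)
    show "(\<lambda>(c, x). c(Suc k := x)) (restrict c {1..k}, c (Suc k)) = c"
      if "c \<in> trace_prefixes p a (Suc k)" for c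
      using that by (auto simp: trace_prefixes_def PiE_iff extensional_def fun_eq_iff le_Suc_eq)
  qed
  from bij_betw_same_card[OF this]
  have "card (trace_prefixes p a (Suc k)) = (\<Sum>c\<in>trace_prefixes p a k. card (X c))"
    by (simp add: finite_trace_prefixes)
  moreover have "card (X c) = (if p dvd Suc k then ?q else 1)" for c
  proof (cases "p dvd Suc k")
    case False
    \<comment> \<open>\<open>R\<close> only involves coefficients up to k, so the condition on the
      new coefficient x is affine with slope -(k + 1).\<close>
    define R where "R = (\<Sum>j\<in>{1..<Suc k}. c (Suc k - j) * newton_sum c j)"
    have "newton_sum (c(Suc k := x)) (Suc k) = - of_nat (Suc k) * x - R" for x
    proof -
      have "(\<Sum>j\<in>{1..<Suc k}. (c(Suc k := x)) (Suc k - j) * newton_sum (c(Suc k := x)) j) = R"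
        unfolding R_def by (intro sum.cong) (auto simp: upd)
      thus ?thesis by (subst newton_sum.simps) simp
    qed
    moreover have "- N * x - R = A \<longleftrightarrow> x = - (A + R) / N" if "N \<noteq> 0" for N x A :: 'a
    proof -
      have "- N * x - R = A \<longleftrightarrow> - (x * N) = A + R" by (simp add: diff_eq_eq mult.commute)
      also have "\<dots> \<longleftrightarrow> x * N = - (A + R)" by (metis minus_equation_iff)
      finally have "- N * x - R = A \<longleftrightarrow> x * N = - (A + R)" .
      thus ?thesis using that by (simp add: nonzero_eq_divide_eq)
    qed
    moreover have "of_nat (Suc k) \<noteq> (0 :: 'a)" using p[of "Suc k"] False by simp
    ultimately have "X c = {- (a (Suc k) + R) / of_nat (Suc k)}"
      using False by (simp add: X_def del: of_nat_Suc)
    thus ?thesis using False by simp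
  qed (simp add: X_def)
  ultimately show ?case using Suc.IH by (simp add: div_Suc mod_eq_0_iff_dvd)
qed

section \<open>Traces in the special linear group\<close>

lemma coeff_0_char_poly:
  fixes M :: "'a::comm_ring_1 mat"
  assumes M: "M \<in> carrier_mat n n"
  shows "coeff (char_poly M) 0 = (-1) ^ n * det M"
proof -
  have "poly (det (char_poly_matrix M)) 0 = det ((-1) \<cdot>\<^sub>m M)"
  proof (rule poly_det_cong[of _ n])
    show "poly (char_poly_matrix M $$ (i, j)) 0 = ((-1) \<cdot>\<^sub>m M) $$ (i, j)" if "i < n" "j < n" for i j
      using that M by (auto simp: char_poly_matrix_def)
  qed (use M in auto)
  also have "\<dots> = (-1) ^ n * det M" using M by simp
  finally show ?thesis by (simp add: char_poly_def poly_0_coeff_0)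
qed

text \<open>Scaling row 0 by x multiplies the determinant by x, so each invertible matrix is a
  unique scaling of one of determinant 1; \<open>n > 0\<close> supplies the row.\<close>

lemma card_GL_mat_eq_card_SL_mat:
  assumes "n > 0"
  shows "card (GL_mat n :: 'a::{field,finite} mat set)
    = (card (UNIV :: 'a set) - 1) * card (SL_mat n :: 'a mat set)"
proof -
  have inv: "multrow 0 x (multrow 0 y M) = M" if "x * y = 1" for x y and M :: "'a mat"
    by (intro eq_matI) (auto simp: that simp flip: mult.assoc)
  have "bij_betw (\<lambda>(x, M). multrow 0 x M) ((UNIV - {0}) \<times> (SL_mat n :: 'a mat set)) (GL_mat n)"
  proof (rule bij_betwI[where g = "\<lambda>M. (det M, multrow 0 (1 / det M) M)"])
    show "(\<lambda>(x, M). multrow 0 x M) \<in> (UNIV - {0}) \<times> (SL_mat n :: 'a mat set) \<rightarrow> GL_mat n"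
      using assms by (auto simp: SL_mat_def GL_mat_def det_multrow)
    show "(\<lambda>M. (det M, multrow 0 (1 / det M) M)) \<in> GL_mat n \<rightarrow> (UNIV - {0}) \<times> (SL_mat n :: 'a mat set)"
      using assms by (auto simp: SL_mat_def GL_mat_def det_multrow)
  qed (use assms in \<open>auto simp: SL_mat_def GL_mat_def det_multrow inv\<close>)
  from bij_betw_same_card[OF this] show ?thesis
    by (simp add: card_cartesian_product card_Diff_singleton)
qed

text \<open>The constant coefficient encodes determinant 1, since chi_M(0) = (-1)^n det M.\<close>

definition SL_char_polys :: "nat \<Rightarrow> nat \<Rightarrow> (nat \<Rightarrow> 'a::comm_ring_1) \<Rightarrow> 'a poly set" where
  "SL_char_polys n k c = {f. degree f = n \<and> coeff f 0 = (-1) ^ n \<and> (\<forall>i\<in>{1..k}. coeff f (n - i) = c i)}"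

text \<open>A singular \<open>D\<close> makes the constant term of the product zero. Thus only
  \<open>GL_mat e\<close> contributes, the very set whose size is divided out later.\<close>

lemma card_SL_char_polys_factor:
  fixes D :: "'a::{field,finite} mat"
  assumes D: "D \<in> carrier_mat e e"
  shows "card {g. degree g = d \<and> coeff g d = 1 \<and> g * char_poly D \<in> SL_char_polys (d + e) k c}
    = (if det D = 0 then 0 else card (prefix_multiples d k (char_poly D) c ((-1) ^ (d + e))))"
proof (cases "det D = 0")
  case True
  have "coeff (g * char_poly D) 0 = 0" for g
    using True coeff_0_char_poly[OF D] by (simp add: coeff_mult)
  hence empty: "{g. degree g = d \<and> coeff g d = 1 \<and> g * char_poly D \<in> SL_char_polys (d + e) k c} = {}"
    by (auto simp: SL_char_polys_def)
  show ?thesis unfolding empty using True by simp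
next
  case False
  have deg: "degree (char_poly D) = e" "char_poly D \<noteq> 0" using degree_monic_char_poly[OF D] by auto
  have "degree (g * char_poly D) = d + e" if "degree g = d" "coeff g d = 1" for g
    using that deg by (subst degree_mult_eq) auto
  hence "{g. degree g = d \<and> coeff g d = 1 \<and> g * char_poly D \<in> SL_char_polys (d + e) k c}
      = prefix_multiples d k (char_poly D) c ((-1) ^ (d + e))"
    by (auto simp: SL_char_polys_def prefix_multiples_def deg)
  thus ?thesis using False by simp
qed

text \<open>After division by |GL_(n-d)| each dimension contributes a mean of fibre sizes: an exact
  power of q for d > k, and a number between 0 and 1 for d <= k.\<close>

lemma card_SL_char_polys:
  fixes c :: "nat \<Rightarrow> 'a::{field,finite}" and n k :: nat
  defines "q \<equiv> real (card (UNIV :: 'a set))" and "G \<equiv> real (card (GL_mat n :: 'a mat set))"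
  assumes "k \<le> n"
  obtains \<theta> where "0 \<le> \<theta>" "\<theta> \<le> real k + 1"
    "q ^ n * real (card {M \<in> carrier_mat n n. char_poly M \<in> SL_char_polys n k c})
      = G * ((\<Sum>j<n - k. q ^ j) + \<theta>)"
proof -
  define S where "S d = real (\<Sum>D\<in>carrier_mat (n - d) (n - d).
    card {g. degree g = d \<and> coeff g d = 1 \<and> g * char_poly D \<in> SL_char_polys n k c})
    / real (card (GL_mat (n - d) :: 'a mat set))" for d
  have S: "S d = (\<Sum>D\<in>GL_mat (n - d). real (card (prefix_multiples d k (char_poly D) c ((-1) ^ n))))
    / real (card (GL_mat (n - d) :: 'a mat set))" if "d \<le> n" for d
  proof -
    have n: "d + (n - d) = n" using that by simp
    have "(\<Sum>D\<in>carrier_mat (n - d) (n - d).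
        card {g. degree g = d \<and> coeff g d = 1 \<and> g * char_poly D \<in> SL_char_polys n k c})
      = (\<Sum>D\<in>carrier_mat (n - d) (n - d). if det D = 0 then 0
          else card (prefix_multiples d k (char_poly D) c ((-1) ^ n)))"
      using card_SL_char_polys_factor[of _ "n - d" d k c] n by (intro sum.cong) auto
    also have "\<dots> = (\<Sum>D\<in>GL_mat (n - d). card (prefix_multiples d k (char_poly D) c ((-1) ^ n)))"
      by (rule sum.mono_neutral_cong_right) (auto simp: GL_mat_def)
    finally show ?thesis by (simp add: S_def)
  qed
  have nz: "coeff (char_poly D) 0 \<noteq> 0" if "D \<in> GL_mat m" for D :: "'a mat" and m
    using that coeff_0_char_poly[of D m] by (auto simp: GL_mat_def)
  have G_pos: "real (card (GL_mat m :: 'a mat set)) > 0" for m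
    using card_GL_mat_pos by (simp only: of_nat_0_less_iff)
  have large: "S d = q ^ (d - k - 1)" if "k < d" "d \<le> n" for d
  proof -
    have "S d = (\<Sum>D\<in>(GL_mat (n - d) :: 'a mat set). q ^ (d - k - 1)) / real (card (GL_mat (n - d) :: 'a mat set))"
      unfolding S[OF that(2)]
      by (rule arg_cong2[where f = "(/)"], rule sum.cong) (auto simp: card_prefix_multiples[OF nz that(1)] q_def)
    thus ?thesis using G_pos[of "n - d"] by auto
  qed
  have small: "0 \<le> S d \<and> S d \<le> 1" if "d \<le> k" for d
  proof -
    have "(\<Sum>D\<in>GL_mat (n - d). real (card (prefix_multiples d k (char_poly D) c ((-1) ^ n))))
        \<le> (\<Sum>D\<in>(GL_mat (n - d) :: 'a mat set). 1)"
    proof (rule sum_mono)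
      fix D :: "'a mat" assume "D \<in> GL_mat (n - d)"
      from card_prefix_multiples_le_one[OF nz[OF this] that, of c "(-1) ^ n"]
      show "real (card (prefix_multiples d k (char_poly D) c ((-1) ^ n))) \<le> 1" by linarith
    qed
    moreover have "d \<le> n" using that \<open>k \<le> n\<close> by simp
    ultimately show ?thesis
      unfolding S[OF \<open>d \<le> n\<close>] using G_pos[of "n - d"]
      by (intro conjI divide_nonneg_nonneg sum_nonneg) (simp_all add: divide_le_eq_1)
  qed
  \<comment> \<open>Collects the k + 1 inexact dimensions d = 0, ..., k, whence the bound k +
    1.\<close>
  define \<theta> where "\<theta> = (\<Sum>d\<le>k. S d)"
  have "(\<Sum>d\<le>n. S d) = (\<Sum>d\<in>{..k} \<union> {Suc k..n}. S d)"
    using \<open>k \<le> n\<close> by (intro sum.cong) auto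
  also have "\<dots> = \<theta> + (\<Sum>d\<in>{Suc k..n}. S d)"
    unfolding \<theta>_def by (rule sum.union_disjoint) auto
  also have "(\<Sum>d\<in>{Suc k..n}. S d) = (\<Sum>d\<in>{Suc k..n}. q ^ (d - k - 1))"
    by (intro sum.cong refl large) auto
  also have "\<dots> = (\<Sum>j<n - k. q ^ j)"
    by (rule sum.reindex_bij_witness[of _ "\<lambda>j. j + k + 1" "\<lambda>d. d - k - 1"]) auto
  finally have sum_S: "(\<Sum>d\<le>n. S d) = (\<Sum>j<n - k. q ^ j) + \<theta>" by simp
  have "q ^ n * real (card {M \<in> carrier_mat n n. char_poly M \<in> SL_char_polys n k c}) = (\<Sum>d\<le>n. G * S d)"
    unfolding q_def G_def S_def card_char_poly_in by simp
  also have "\<dots> = G * ((\<Sum>j<n - k. q ^ j) + \<theta>)"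
    by (simp add: sum_S flip: sum_distrib_left)
  finally show thesis
  proof (rule that[rotated 2])
    show "0 \<le> \<theta>" unfolding \<theta>_def using small by (intro sum_nonneg) auto
    have "\<theta> \<le> (\<Sum>d\<le>k. 1)" unfolding \<theta>_def using small by (intro sum_mono) auto
    thus "\<theta> \<le> real k + 1" by simp
  qed
qed

lemma SL_mat_prefix_probability:
  fixes c :: "nat \<Rightarrow> 'a::{field,finite}" and n k :: nat
  defines "q \<equiv> real (card (UNIV :: 'a set))"
  assumes "1 \<le> k" "k \<le> n"
  shows "\<bar>real (card {M \<in> carrier_mat n n. char_poly M \<in> SL_char_polys n k c})
      / real (card (SL_mat n :: 'a mat set)) - 1 / q ^ k\<bar> \<le> (q - 1) * (real k + 1) / q ^ n"
proof -
  let ?N = "real (card {M \<in> carrier_mat n n. char_poly M \<in> SL_char_polys n k c})"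
  let ?s = "real (card (SL_mat n :: 'a mat set))"
  have "card {0, 1 :: 'a} \<le> card (UNIV :: 'a set)" by (intro card_mono) auto
  hence two: "2 \<le> card (UNIV :: 'a set)" by simp
  hence q: "q \<ge> 2" by (simp add: q_def)
  have G: "real (card (GL_mat n :: 'a mat set)) = (q - 1) * ?s"
    using assms two by (simp add: card_GL_mat_eq_card_SL_mat q_def of_nat_diff)
  have "real (card (GL_mat n :: 'a mat set)) > 0"
    using card_GL_mat_pos by (simp only: of_nat_0_less_iff)
  hence s: "?s > 0" using G by (simp add: zero_less_mult_iff)
  obtain \<theta> where \<theta>: "0 \<le> \<theta>" "\<theta> \<le> real k + 1"
    and N: "q ^ n * ?N = (q - 1) * ?s * ((\<Sum>j<n - k. q ^ j) + \<theta>)"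
    by (rule card_SL_char_polys[OF \<open>k \<le> n\<close>, of c, folded q_def, unfolded G])
  have geo: "(q - 1) * (\<Sum>j<n - k. q ^ j) = q ^ (n - k) - 1"
    using power_diff_1_eq[of q "n - k"] by simp
  have "q ^ n * ?N = ?s * ((q - 1) * (\<Sum>j<n - k. q ^ j) + (q - 1) * \<theta>)"
    unfolding N by (simp add: algebra_simps)
  hence "q ^ n * ?N = ?s * (q ^ (n - k) - 1 + (q - 1) * \<theta>)" by (simp only: geo)
  hence "?N / ?s = (q ^ (n - k) - 1 + (q - 1) * \<theta>) / q ^ n" using s q by (simp add: field_simps)
  \<comment> \<open>The main term is q^(n-k) / q^n; the -1 is the lower end of the telescoped
    geometric sum.\<close>
  also have "\<dots> = 1 / q ^ k + ((q - 1) * \<theta> - 1) / q ^ n"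
    using q \<open>k \<le> n\<close> by (simp add: power_diff field_simps)
  finally have eq: "\<bar>?N / ?s - 1 / q ^ k\<bar> = \<bar>(q - 1) * \<theta> - 1\<bar> / q ^ n"
    using q by simp
  have "(q - 1) * \<theta> \<le> (q - 1) * (real k + 1)" using \<theta> q by (intro mult_left_mono) auto
  moreover have "0 \<le> (q - 1) * \<theta>" using \<theta> q by simp
  \<comment> \<open>Absorbs the -1 when \<open>(q - 1) * \<theta>\<close> is too small to outweigh
    it.\<close>
  moreover have "1 * 1 \<le> (q - 1) * (real k + 1)" using q by (intro mult_mono) auto
  ultimately have "\<bar>(q - 1) * \<theta> - 1\<bar> \<le> (q - 1) * (real k + 1)" by linarith
  thus ?thesis unfolding eq using q by (intro divide_right_mono) auto
qed

text \<open>The traces are functions of the prefix alone, so the trace event splits according to the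
  compatible prefixes.\<close>

lemma SL_mat_traces_eq_UN_prefixes:
  fixes a :: "nat \<Rightarrow> 'a::field"
  assumes "k \<le> n"
  shows "{M \<in> SL_mat n. \<forall>i\<in>{1..k}. \<not> p dvd i \<longrightarrow> mat_trace (M ^\<^sub>m i) = a i}
    = (\<Union>c\<in>trace_prefixes p a k. {M \<in> carrier_mat n n. char_poly M \<in> SL_char_polys n k c})"
    (is "?L = ?R")
proof -
  have SL: "M \<in> SL_mat n \<longleftrightarrow> coeff (char_poly M) 0 = (-1) ^ n" if "M \<in> carrier_mat n n" for M :: "'a mat"
    using that by (simp add: SL_mat_def coeff_0_char_poly)
  have tr: "mat_trace (M ^\<^sub>m i) = newton_sum c i"
    if "M \<in> carrier_mat n n" "i \<in> {1..k}" "\<forall>j\<in>{1..k}. coeff (char_poly M) (n - j) = c j" for M :: "'a mat" and i c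
  proof -
    have "mat_trace (M ^\<^sub>m i) = newton_sum (\<lambda>j. coeff (char_poly M) (n - j)) i"
      using that \<open>k \<le> n\<close> by (intro mat_trace_pow_eq_newton_sum) auto
    also have "\<dots> = newton_sum c i" using that by (intro newton_sum_cong) auto
    finally show ?thesis .
  qed
  show ?thesis
  proof (intro equalityI subsetI)
    fix M assume M: "M \<in> ?L"
    hence Mc: "M \<in> carrier_mat n n" by (simp add: SL_mat_def)
    define c where "c = restrict (\<lambda>j. coeff (char_poly M) (n - j)) {1..k}"
    have c: "\<forall>j\<in>{1..k}. coeff (char_poly M) (n - j) = c j" by (simp add: c_def)
    have "c \<in> PiE {1..k} (\<lambda>_. UNIV)" by (simp add: c_def)
    hence "c \<in> trace_prefixes p a k"
      using M tr[OF Mc _ c] by (auto simp: trace_prefixes_def)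
    moreover have "char_poly M \<in> SL_char_polys n k c"
      using M SL[OF Mc] c degree_monic_char_poly[OF Mc] by (auto simp: SL_char_polys_def)
    ultimately show "M \<in> ?R" using Mc by auto
  next
    fix M assume "M \<in> ?R"
    then obtain c where c: "c \<in> trace_prefixes p a k" and Mc: "M \<in> carrier_mat n n"
      and \<Phi>: "char_poly M \<in> SL_char_polys n k c" by auto
    have "\<forall>j\<in>{1..k}. coeff (char_poly M) (n - j) = c j"
      using \<Phi> by (simp add: SL_char_polys_def)
    from tr[OF Mc _ this] have "\<forall>i\<in>{1..k}. \<not> p dvd i \<longrightarrow> mat_trace (M ^\<^sub>m i) = a i"
      using c by (simp add: trace_prefixes_def)
    moreover have "M \<in> SL_mat n" using SL[OF Mc] \<Phi> by (simp add: SL_char_polys_def)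
    ultimately show "M \<in> ?L" by simp
  qed
qed

theorem theorem4p9:
  fixes p r q n k :: nat and a :: "nat \<Rightarrow> 'a::{field, finite}"
  assumes "prime p" and "q = p ^ r" and "card (UNIV :: 'a set) = q" and "of_nat p = (0::'a)"
    and "1 \<le> k" and "k \<le> n"
  shows "\<bar>real (card {M \<in> SL_mat n. \<forall>i\<in>{1..k}. \<not> p dvd i \<longrightarrow> mat_trace (M ^\<^sub>m i) = a i})
            / real (card (SL_mat n :: 'a mat set))
          - 1 / real q ^ (k - k div p)\<bar>
         \<le> (real q - 1) * (real k + 1) * real q ^ (k div p) / real q ^ n"
proof -
  let ?T = "trace_prefixes p a k"
  let ?N = "\<lambda>c. real (card {M \<in> carrier_mat n n. char_poly M \<in> SL_char_polys n k c})"
  let ?s = "real (card (SL_mat n :: 'a mat set))"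
  have p0: "of_nat i = (0 :: 'a) \<longleftrightarrow> p dvd i" for i
  proof
    assume i: "of_nat i = (0 :: 'a)"
    show "p dvd i"
    proof (rule ccontr)
      assume "\<not> p dvd i"
      hence "coprime p i" using \<open>prime p\<close> by (rule prime_imp_coprime[rotated])
      \<comment> \<open>Bezout over the naturals: under \<open>of_nat\<close> both products vanish,
        leaving 0 = 1.\<close>
      then obtain x y where "i * x = p * y + 1"
        using coprime_bezout_strong[of i p] prime_gt_1_nat[OF \<open>prime p\<close>] by (auto simp: coprime_commute)
      hence "(of_nat i * of_nat x :: 'a) = of_nat p * of_nat y + 1"
        by (metis of_nat_1 of_nat_add of_nat_mult)
      thus False using i \<open>of_nat p = (0 :: 'a)\<close> by simp
    qed
  next
    assume "p dvd i"
    thus "of_nat i = (0 :: 'a)" using \<open>of_nat p = (0 :: 'a)\<close> by (auto elim!: dvdE)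
  qed
  have "p > 0" using \<open>prime p\<close> prime_gt_0_nat by blast
  have card_T: "card ?T = q ^ (k div p)"
    using card_trace_prefixes[OF p0 \<open>p > 0\<close>, of a k] assms(3) by simp
  have q: "real q > 0" using assms(3) finite_UNIV_card_ge_0[where 'a = 'a] by auto
  have "card {M \<in> SL_mat n. \<forall>i\<in>{1..k}. \<not> p dvd i \<longrightarrow> mat_trace (M ^\<^sub>m i) = a i}
      = (\<Sum>c\<in>?T. card {M \<in> carrier_mat n n. char_poly M \<in> SL_char_polys n k c})"
    unfolding SL_mat_traces_eq_UN_prefixes[OF \<open>k \<le> n\<close>]
  proof (rule card_UN_disjoint)
    show "\<forall>c\<in>?T. \<forall>c'\<in>?T. c \<noteq> c' \<longrightarrow> {M \<in> carrier_mat n n. char_poly M \<in> SL_char_polys n k c}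
        \<inter> {M \<in> carrier_mat n n. char_poly M \<in> SL_char_polys n k c'} = {}"
    proof (intro ballI impI)
      fix c c' assume "c \<in> ?T" "c' \<in> ?T" "c \<noteq> c'"
      then obtain i where "i \<in> {1..k}" "c i \<noteq> c' i"
        using PiE_ext[of c "{1..k}" "\<lambda>_. UNIV" c'] by (auto simp: trace_prefixes_def)
      thus "{M \<in> carrier_mat n n. char_poly M \<in> SL_char_polys n k c}
        \<inter> {M \<in> carrier_mat n n. char_poly M \<in> SL_char_polys n k c'} = {}"
        by (auto simp: SL_char_polys_def)
    qed
  qed (use finite_trace_prefixes in auto)
  \<comment> \<open>The target equals |T| copies of the main term q^(-k), so the total error is at
    most q^(k div p) times the error for one prefix.\<close>
  moreover have "1 / real q ^ (k - k div p) = real (card ?T) / real q ^ k"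
    using q by (simp add: card_T power_diff)
  ultimately have "\<bar>real (card {M \<in> SL_mat n. \<forall>i\<in>{1..k}. \<not> p dvd i \<longrightarrow> mat_trace (M ^\<^sub>m i) = a i}) / ?s
      - 1 / real q ^ (k - k div p)\<bar> = \<bar>\<Sum>c\<in>?T. ?N c / ?s - 1 / real q ^ k\<bar>"
    by (simp add: sum_subtractf sum_divide_distrib)
  also have "\<dots> \<le> (\<Sum>c\<in>?T. \<bar>?N c / ?s - 1 / real q ^ k\<bar>)" by (rule sum_abs)
  also have "\<dots> \<le> (\<Sum>c\<in>?T. (real q - 1) * (real k + 1) / real q ^ n)"
    using SL_mat_prefix_probability[OF assms(5,6), where 'a = 'a] assms(3) by (intro sum_mono) simp
  also have "\<dots> = (real q - 1) * (real k + 1) * real q ^ (k div p) / real q ^ n"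
    by (simp add: card_T)
  finally show ?thesis .
qed

end
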